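(* Let $(X,d_X)$ be an $n$-point metric space with aspect ratio $\Phi$, and let $\epsilon\in(0,1]$. There is a uniform distribution $\mathcal{D}$ over $O(n\log n/\epsilon^2)$ clan embeddings $(f,\chi)$ of $X$ into ultrametrics, each with multiplicative distortion $O(\frac{\log n}{\epsilon})$ and path distortion $O(\frac{\log n}{\epsilon})\cdot\min\{\log n,\log\Phi\}$, such that for every $x\in X$, $\mathbb{E}_{(f,\chi)\sim\mathcal{D}}[|f(x)|]\le1+\epsilon$. In addition, for every $k\in\mathbb{N}$ there is a uniform distribution $\mathcal{D}$ over $O(n^{1+\frac2k}\log n)$ clan embeddings $(f,\chi)$ of $X$ into ultrametrics, each with multiplicative distortion $16(k+1)$ and path distortion $O(k)\cdot\min\{\log n,\log\Phi\}$, such that for every $x\in X$, $\mathbb{E}_{(f,\chi)\sim\mathcal{D}}[|f(x)|]=O(n^{\frac1k})$.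
   Context: The aspect ratio of $X$ is $\max_{x,y}d_X(x,y)/\min_{x\ne y}d_X(x,y)$. An ultrametric is a metric space with $d(x,z)\le\max\{d(x,y),d(y,z)\}$. A one-to-many embedding $f:X\to 2^Y$ maps each $x$ to a non-empty set $f(x)$, the sets pairwise disjoint; it is dominating if $d_X(x,y)\le\min_{x'\in f(x),y'\in f(y)}d_Y(x',y')$. A clan embedding is a pair $(f,\chi)$ with $f$ a dominating one-to-many embedding and $\chi(x)\in f(x)$; it has multiplicative distortion $t$ if $\min_{y'\in f(y)}d_Y(y',\chi(x))\le t\cdot d_X(x,y)$ for all $x,y$. A one-to-many embedding $f$ has path distortion $t$ if for every sequence $x_0,\dots,x_m$ in $X$ there are $x_i'\in f(x_i)$ with $\sum_{i=0}^{m-1}d_Y(x'_i,x'_{i+1})\le t\cdot\sum_{i=0}^{m-1}d_X(x_i,x_{i+1})$.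
   Formalization: The factor log Φ is read as max{1, log Φ}, since for Φ = 1 (any two-point space) the stated path distortion would be 0, which no dominating embedding attains; n ≥ 2 is assumed so that the aspect ratio is defined. *)

theory Defs
  imports "HOL-Probability.Probability"
begin

text \<open>
  The domain is the finite metric space \<open>Metric_space X d\<close>. Only the points of the sets \<open>f x\<close> of an
  ultrametric matter and these are finitely many, so all ultrametrics have a carrier of type
  \<^typ>\<open>nat set\<close>.
\<close>

text \<open>Meaningful if \<open>X\<close> is finite with at least two points.\<close>

definition aspect_ratio :: "'a set \<Rightarrow> ('a \<Rightarrow> 'a \<Rightarrow> real) \<Rightarrow> real" where
  "aspect_ratio X d = Max {d x y | x y. x \<in> X \<and> y \<in> X} / Min {d x y | x y. x \<in> X \<and> y \<in> X \<and> x \<noteq> y}"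

locale ultrametric = Metric_space +
  assumes ultra_triangle:
    "\<lbrakk>x \<in> M; y \<in> M; z \<in> M\<rbrakk> \<Longrightarrow> d x z \<le> max (d x y) (d y z)"

text \<open>
  Copy sets are required to be finite: otherwise the minima below could be undefined, and \<^const>\<open>card\<close>
  would count an infinite copy set as \<open>0\<close>.
\<close>

definition one_to_many_embedding :: "'a set \<Rightarrow> 'b set \<Rightarrow> ('a \<Rightarrow> 'b set) \<Rightarrow> bool" where
  "one_to_many_embedding X Y f \<longleftrightarrow>
     (\<forall>x\<in>X. f x \<noteq> {} \<and> finite (f x) \<and> f x \<subseteq> Y) \<and> disjoint_family_on f X"

definition dominating ::
  "'a set \<Rightarrow> ('a \<Rightarrow> 'a \<Rightarrow> real) \<Rightarrow> ('b \<Rightarrow> 'b \<Rightarrow> real) \<Rightarrow> ('a \<Rightarrow> 'b set) \<Rightarrow> bool" where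
  "dominating X d dY f \<longleftrightarrow>
     (\<forall>x\<in>X. \<forall>y\<in>X. d x y \<le> Min {dY x' y' | x' y'. x' \<in> f x \<and> y' \<in> f y})"

definition clan_embedding ::
  "'a set \<Rightarrow> ('a \<Rightarrow> 'a \<Rightarrow> real) \<Rightarrow> 'b set \<Rightarrow> ('b \<Rightarrow> 'b \<Rightarrow> real) \<Rightarrow> ('a \<Rightarrow> 'b set) \<Rightarrow> ('a \<Rightarrow> 'b) \<Rightarrow> bool" where
  "clan_embedding X d Y dY f chi \<longleftrightarrow>
     one_to_many_embedding X Y f \<and> dominating X d dY f \<and> (\<forall>x\<in>X. chi x \<in> f x)"

definition multiplicative_distortion ::
  "'a set \<Rightarrow> ('a \<Rightarrow> 'a \<Rightarrow> real) \<Rightarrow> ('b \<Rightarrow> 'b \<Rightarrow> real) \<Rightarrow> ('a \<Rightarrow> 'b set) \<Rightarrow> ('a \<Rightarrow> 'b) \<Rightarrow> real \<Rightarrow> bool" where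
  "multiplicative_distortion X d dY f chi t \<longleftrightarrow>
     (\<forall>x\<in>X. \<forall>y\<in>X. Min {dY y' (chi x) | y'. y' \<in> f y} \<le> t * d x y)"

definition path_distortion ::
  "'a set \<Rightarrow> ('a \<Rightarrow> 'a \<Rightarrow> real) \<Rightarrow> ('b \<Rightarrow> 'b \<Rightarrow> real) \<Rightarrow> ('a \<Rightarrow> 'b set) \<Rightarrow> real \<Rightarrow> bool" where
  "path_distortion X d dY f t \<longleftrightarrow>
     (\<forall>(m::nat) p. (\<forall>i\<le>m. p i \<in> X) \<longrightarrow>
        (\<exists>p'. (\<forall>i\<le>m. p' i \<in> f (p i)) \<and>
              (\<Sum>i<m. dY (p' i) (p' (Suc i))) \<le> t * (\<Sum>i<m. d (p i) (p (Suc i)))))"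

text \<open>
  Target carrier, target metric, \<open>f\<close> and \<open>chi\<close>. Different members of a distribution may have different
  targets.
\<close>

type_synonym 'a clan_map = "nat set \<times> (nat \<Rightarrow> nat \<Rightarrow> real) \<times> ('a \<Rightarrow> nat set) \<times> ('a \<Rightarrow> nat)"

definition expected_copies :: "'a clan_map set \<Rightarrow> 'a \<Rightarrow> real" where
  "expected_copies S x = measure_pmf.expectation (pmf_of_set S) (\<lambda>(Y, dY, f, chi). real (card (f x)))"

text \<open>
  The factor \<open>min {log n, log \<Phi>}\<close> of the path distortion. A dominating embedding has no path distortion
  below \<open>1\<close>, hence \<open>log \<Phi>\<close> inside an \<open>O\<close>-bound is read as usual as bounded below by a positive constant.
  For \<open>\<Phi> \<ge> 2\<close> the maximum is just \<open>log 2 \<Phi>\<close>.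
\<close>

definition path_factor :: "nat \<Rightarrow> real \<Rightarrow> real" where
  "path_factor n \<Phi> = min (log 2 n) (max 1 (log 2 \<Phi>))"

end

theory Submission
  imports Defs
begin

text \<open>
  A cluster \<open>Z\<close> of diameter \<open>D\<close> is covered by a ball \<open>A\<close> of radius at most \<open>D / 4\<close> and by the
  complement \<open>B\<close> of a slightly smaller concentric ball; the points of the annulus \<open>A \<inter> B\<close> are copied
  into both. Recursing into \<open>A\<close> and \<open>B\<close> and joining the results at height \<open>D\<close> gives an ultrametric.
  The annulus has width \<open>g = D / (8 * (k + 1))\<close>, so if \<open>chi x\<close> is placed according to the middle
  radius, any point not copied to the side of \<open>chi x\<close> is at distance at least \<open>g / 2\<close> from \<open>x\<close>.
  By a volume growth argument the annulus can be chosen so that the weighted number of copies is at most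
  \<open>\<mu>(X) powr (1 + 1 / k)\<close>, and such that \<open>A\<close> or \<open>B\<close> contains at most half of the points.

  For the path distortion, the edges that leave a side are paid for by the subpaths of the half-sized side
  (which bounds the number of charges per edge by \<open>log n\<close>), or by those of \<open>A\<close>, whose diameter is at
  most \<open>D / 2\<close> (which bounds it by \<open>1 + log \<Phi>\<close>).

  The distribution comes from multiplicative weights. Measured by \<open>\<mu> = 1 + n * w\<close>, where the weights \<open>w\<close>
  sum to 1, the excess \<open>|f x| - 1\<close> has \<open>w\<close>-average at most \<open>\<delta> = 2 * ((2 * n) powr (1 / k) - 1)\<close> and is
  at most \<open>n * \<delta>\<close> at each point, so \<open>O(n log n)\<close> rounds suffice. The first part is the case
  \<open>k \<approx> 12 * ln (2 * n) / \<epsilon>\<close>.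
\<close>

subsection \<open>Lifting paths\<close>

fun path_length :: "('a \<Rightarrow> 'a \<Rightarrow> real) \<Rightarrow> 'a list \<Rightarrow> real" where
  "path_length d (x # y # xs) = d x y + path_length d (y # xs)"
| "path_length d _ = 0"

definition path_lift ::
  "('a \<Rightarrow> 'a \<Rightarrow> real) \<Rightarrow> ('b \<Rightarrow> 'b \<Rightarrow> real) \<Rightarrow> ('a \<Rightarrow> 'b set) \<Rightarrow> 'a set \<Rightarrow> real \<Rightarrow> bool" where
  "path_lift d \<rho> f Z H \<longleftrightarrow>
     (\<forall>xs\<in>lists Z. \<exists>ys. list_all2 (\<lambda>x y. y \<in> f x) xs ys \<and> path_length \<rho> ys \<le> H * path_length d xs)"

lemma path_length_append:
  assumes "xs \<noteq> []" "ys \<noteq> []"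
  shows "path_length d (xs @ ys) = path_length d xs + d (last xs) (hd ys) + path_length d ys"
  using assms
proof (induction xs rule: induct_list012)
  case (2 x)
  then show ?case by (cases ys) auto
qed auto

lemma path_length_nonneg:
  assumes "\<And>x y. 0 \<le> d x y"
  shows "0 \<le> path_length d xs"
  using assms by (induction xs rule: induct_list012) (auto simp: add_nonneg_nonneg)

lemma path_length_map: "path_length d (map g xs) = path_length (\<lambda>x y. d (g x) (g y)) xs"
  by (induction xs rule: induct_list012) auto

lemma path_length_map_upt:
  "path_length d (map p [0..<Suc m]) = (\<Sum>i<m. d (p i) (p (Suc i)))"
proof (induction m)
  case (Suc m)
  have "path_length d (map p [0..<Suc (Suc m)])
      = path_length d (map p [0..<Suc m] @ [p (Suc m)])" by simp
  also have "\<dots> = path_length d (map p [0..<Suc m]) + d (p m) (p (Suc m))"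
    by (subst path_length_append) (auto simp: last_map)
  finally show ?case using Suc.IH by simp
qed auto

lemma path_lift_mono:
  assumes "path_lift d \<rho> f Z H" "H \<le> H'" "\<And>x y. 0 \<le> d x y"
  shows "path_lift d \<rho> f Z H'"
  unfolding path_lift_def
proof
  fix xs assume "xs \<in> lists Z"
  then obtain ys where "list_all2 (\<lambda>x y. y \<in> f x) xs ys" "path_length \<rho> ys \<le> H * path_length d xs"
    using assms(1) unfolding path_lift_def by blast
  moreover have "H * path_length d xs \<le> H' * path_length d xs"
    using assms path_length_nonneg[of d] by (intro mult_right_mono) auto
  ultimately show "\<exists>ys. list_all2 (\<lambda>x y. y \<in> f x) xs ys \<and> path_length \<rho> ys \<le> H' * path_length d xs"
    by (meson order_trans)
qed

lemma path_lift_map: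
  assumes "path_lift d \<rho> f Z H" "\<And>u v. \<rho>' (g u) (g v) = \<rho> u v" "\<And>x. x \<in> Z \<Longrightarrow> g ` f x \<subseteq> f' x"
  shows "path_lift d \<rho>' f' Z H"
  unfolding path_lift_def
proof
  fix xs assume xs: "xs \<in> lists Z"
  then obtain ys where ys: "list_all2 (\<lambda>x y. y \<in> f x) xs ys" "path_length \<rho> ys \<le> H * path_length d xs"
    using assms(1) unfolding path_lift_def by blast
  have "list_all2 (\<lambda>x y. y \<in> f' x) xs (map g ys)"
    using xs ys(1) assms(3) unfolding list_all2_conv_all_nth by (fastforce simp: in_set_conv_nth)
  moreover have "path_length \<rho>' (map g ys) = path_length \<rho> ys"
    by (simp add: path_length_map assms(2))
  ultimately show "\<exists>ys. list_all2 (\<lambda>x y. y \<in> f' x) xs ys \<and> path_length \<rho>' ys \<le> H * path_length d xs"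
    using ys(2) by metis
qed

context Metric_space
begin

lemma path_length_ge_dist_hd:
  assumes "x \<in> M" "set xs \<subseteq> M" "a \<in> set xs"
  shows "d x a \<le> path_length d (x # xs)"
  using assms
proof (induction xs arbitrary: x)
  case (Cons y ys)
  then show ?case
  proof (cases "a = y")
    case True
    then show ?thesis using path_length_nonneg[of d "y # ys"] by simp
  next
    case False
    then have "d y a \<le> path_length d (y # ys)" using Cons by auto
    moreover have "d x a \<le> d x y + d y a" using Cons.prems by (intro triangle) auto
    ultimately show ?thesis by simp
  qed
qed simp

lemma path_length_rev: "path_length d (rev xs) = path_length d xs"
proof (induction xs rule: induct_list012)
  case (3 x y zs)
  have "path_length d (rev (x # y # zs)) = path_length d (rev (y # zs) @ [x])" by simp
  also have "\<dots> = path_length d (rev (y # zs)) + d y x"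
    by (subst path_length_append) (auto simp: last_rev)
  finally show ?case using 3 commute by simp
qed auto

lemma path_length_ge_dist_last:
  assumes "y \<in> M" "set xs \<subseteq> M" "a \<in> set xs"
  shows "d a y \<le> path_length d (xs @ [y])"
  using path_length_ge_dist_hd[of y "rev xs" a] path_length_rev[of "xs @ [y]"] assms
  by (simp add: commute)

lemma path_length_cut:
  assumes "set xs \<subseteq> M" "us @ ps @ ws = xs" "a \<in> set ps" "0 < g" "2 * D \<le> c * g" "0 \<le> c"
    and "us \<noteq> [] \<Longrightarrow> g \<le> d (last us) a" "ws \<noteq> [] \<Longrightarrow> g \<le> d a (hd ws)"
    and nn: "0 \<le> D"
  shows "(if us = [] then 0 else D) + (if ws = [] then 0 else D)
    \<le> c * ((if us = [] then 0 else d (last us) (hd ps)) + path_length d ps + (if ws = [] then 0 else d (last ps) (hd ws)))"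
    (is "?l \<le> c * ?r")
proof (cases "us = [] \<and> ws = []")
  case True
  then show ?thesis using assms path_length_nonneg[of d] by simp
next
  case False
  have ps: "ps \<noteq> []" using assms(3) by auto
  have M: "set us \<subseteq> M" "set ps \<subseteq> M" "set ws \<subseteq> M" using assms(1,2) by auto
  have "g \<le> ?r"
  proof (cases "us = []")
    case False
    have "g \<le> d (last us) a" using False assms by auto
    also have "\<dots> \<le> path_length d (last us # ps)"
      using M assms(3) False by (intro path_length_ge_dist_hd) auto
    also have "\<dots> = d (last us) (hd ps) + path_length d ps" using ps by (cases ps) auto
    also have "\<dots> \<le> ?r" using False by simp
    finally show ?thesis .
  next
    case True
    then have ws: "ws \<noteq> []" using False by simp
    have "g \<le> d a (hd ws)" using ws assms by auto
    also have "\<dots> \<le> path_length d (ps @ [hd ws])"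
      using M assms(3) ws by (intro path_length_ge_dist_last) auto
    also have "\<dots> = path_length d ps + d (last ps) (hd ws)" using ps by (simp add: path_length_append)
    also have "\<dots> \<le> ?r" using ws by simp
    finally show ?thesis .
  qed
  then have "c * g \<le> c * ?r" using assms by (intro mult_left_mono) auto
  moreover have "?l \<le> 2 * D" using nn by auto
  ultimately show ?thesis using assms by linarith
qed

text \<open>
  The subpaths of \<open>A\<close> that leave \<open>B\<close> are cut out at maximal length. Each is incident to at most two
  cut edges, and unless there are none, it has together with them length at least \<open>g\<close>; this pays
  for the cost \<open>2 * D\<close> of the cut edges.
\<close>

lemma path_lift_glue:
  assumes Z: "Z = A \<union> B" "Z \<subseteq> M"
    and A: "path_lift d \<rho> f A (H - c)" and B: "path_lift d \<rho> f B H"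
    and diam: "\<And>x y x' y'. \<lbrakk>x \<in> Z; y \<in> Z; x' \<in> f x; y' \<in> f y\<rbrakk> \<Longrightarrow> \<rho> x' y' \<le> D"
    and gap: "\<And>x y. \<lbrakk>x \<in> A - B; y \<in> B - A\<rbrakk> \<Longrightarrow> g \<le> d x y"
    and g: "0 < g" "2 * D \<le> c * g" "0 \<le> c" "0 \<le> D" "c \<le> H"
  shows "path_lift d \<rho> f Z H"
  unfolding path_lift_def
proof
  fix xs assume "xs \<in> lists Z"
  then show "\<exists>ys. list_all2 (\<lambda>x y. y \<in> f x) xs ys \<and> path_length \<rho> ys \<le> H * path_length d xs"
  proof (induction "length xs" arbitrary: xs rule: less_induct)
    case less
    show ?case
    proof (cases "set xs \<subseteq> B")
      case True
      then show ?thesis using B unfolding path_lift_def by blast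
    next
      case False
      then obtain us a ws where xs: "xs = us @ a # ws" "a \<notin> B" and us: "\<forall>x\<in>set us. \<not> x \<notin> B"
        using split_list_first_prop[of xs "\<lambda>x. x \<notin> B"] by blast
      define u1 where "u1 = rev (dropWhile (\<lambda>x. x \<in> A) (rev us))"
      define u2 where "u2 = rev (takeWhile (\<lambda>x. x \<in> A) (rev us))"
      define w1 where "w1 = takeWhile (\<lambda>x. x \<in> A) ws"
      define w2 where "w2 = dropWhile (\<lambda>x. x \<in> A) ws"
      define ps where "ps = u2 @ a # w1"
      have u: "us = u1 @ u2"
        unfolding u1_def u2_def by (metis rev_append rev_rev_ident takeWhile_dropWhile_id)
      have w: "ws = w1 @ w2" unfolding w1_def w2_def by simp
      have dec: "u1 @ ps @ w2 = xs" using xs u w by (simp add: ps_def)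
      have Zs: "set xs \<subseteq> Z" using less.prems by auto
      have aA: "a \<in> A" using xs Zs Z by auto
      have psA: "set ps \<subseteq> A" unfolding ps_def u2_def w1_def using aA
        by (auto dest: set_takeWhileD)
      have u1B: "set u1 \<subseteq> B" using us u by auto
      have ps0: "ps \<noteq> []" by (simp add: ps_def)
      have lu: "last u1 \<in> B - A" if "u1 \<noteq> []"
      proof -
        have "last u1 \<notin> A" using that unfolding u1_def
          by (metis hd_dropWhile last_rev rev_is_Nil_conv)
        then show ?thesis using u1B that by auto
      qed
      have hw: "hd w2 \<in> B - A" if "w2 \<noteq> []"
      proof -
        have "hd w2 \<notin> A" using that unfolding w2_def by (metis hd_dropWhile)
        moreover have "hd w2 \<in> Z" using that Zs dec by auto
        ultimately show ?thesis using Z by auto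
      qed
      have "length w2 < length xs" using dec ps0 by auto
      moreover have "w2 \<in> lists Z" using Zs dec by auto
      ultimately obtain W where W: "list_all2 (\<lambda>x y. y \<in> f x) w2 W"
        "path_length \<rho> W \<le> H * path_length d w2" using less.hyps by blast
      obtain U where U: "list_all2 (\<lambda>x y. y \<in> f x) u1 U"
        "path_length \<rho> U \<le> H * path_length d u1" using B u1B unfolding path_lift_def by blast
      obtain P where P: "list_all2 (\<lambda>x y. y \<in> f x) ps P"
        "path_length \<rho> P \<le> (H - c) * path_length d ps" using A psA unfolding path_lift_def by blast
      have ne: "U = [] \<longleftrightarrow> u1 = []" "W = [] \<longleftrightarrow> w2 = []" "P \<noteq> []"
        using U(1) P(1) W(1) ps0 by auto
      have mem: "y \<in> (\<Union>x\<in>Z. f x)" if "y \<in> set (U @ P @ W)" for y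
      proof -
        have "list_all2 (\<lambda>x y. y \<in> f x) xs (U @ P @ W)"
          using U P W dec by (metis list_all2_appendI)
        then show ?thesis using that Zs unfolding list_all2_conv_all_nth
          by (metis (no_types, lifting) UN_iff in_set_conv_nth subset_iff)
      qed
      have rD: "\<rho> x y \<le> D" if "x \<in> set (U @ P @ W)" "y \<in> set (U @ P @ W)" for x y
        using mem[OF that(1)] mem[OF that(2)] diam by blast
      define e1 where "e1 = (if u1 = [] then 0 else d (last u1) (hd ps))"
      define e2 where "e2 = (if w2 = [] then 0 else d (last ps) (hd w2))"
      have e: "0 \<le> e1" "0 \<le> e2" by (auto simp: e1_def e2_def)
      have len: "path_length d xs = path_length d u1 + e1 + path_length d ps + e2 + path_length d w2"
        unfolding dec[symmetric] e1_def e2_def using ps0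
        by (cases "u1 = []"; cases "w2 = []") (simp_all add: path_length_append)
      have "path_length \<rho> (U @ P @ W) \<le> path_length \<rho> U + (if u1 = [] then 0 else D)
          + path_length \<rho> P + (if w2 = [] then 0 else D) + path_length \<rho> W"
      proof -
        have "path_length \<rho> (U @ P @ W) = path_length \<rho> U + (if u1 = [] then 0 else \<rho> (last U) (hd P))
          + path_length \<rho> P + (if w2 = [] then 0 else \<rho> (last P) (hd W)) + path_length \<rho> W"
          using ne by (cases "u1 = []"; cases "w2 = []") (simp_all add: path_length_append)
        moreover have "\<rho> (last U) (hd P) \<le> D" if "u1 \<noteq> []" using that ne by (intro rD) auto
        moreover have "\<rho> (last P) (hd W) \<le> D" if "w2 \<noteq> []" using that ne by (intro rD) auto
        ultimately show ?thesis by auto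
      qed
      moreover have "(if u1 = [] then 0 else D) + (if w2 = [] then 0 else D)
          \<le> c * (e1 + path_length d ps + e2)"
        unfolding e1_def e2_def
      proof (rule path_length_cut[OF _ dec])
        show "set xs \<subseteq> M" using Zs Z by auto
        show "a \<in> set ps" by (simp add: ps_def)
        show "g \<le> d (last u1) a" if "u1 \<noteq> []" using gap[of a "last u1"] lu[OF that] aA xs(2) commute
          by (metis DiffI)
        show "g \<le> d a (hd w2)" if "w2 \<noteq> []" using gap hw[OF that] aA xs(2) by blast
      qed (use g in auto)
      moreover have "c * e1 \<le> H * e1" "c * e2 \<le> H * e2" using e g by (auto intro: mult_right_mono)
      ultimately have "path_length \<rho> (U @ P @ W) \<le> H * path_length d xs"
        using U(2) P(2) W(2) unfolding len by (simp add: algebra_simps)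
      moreover have "list_all2 (\<lambda>x y. y \<in> f x) xs (U @ P @ W)"
        using U P W dec by (metis list_all2_appendI)
      ultimately show ?thesis by blast
    qed
  qed
qed

end

lemma path_distortion_if_path_lift:
  assumes "path_lift d \<rho> f X t"
  shows "path_distortion X d \<rho> f t"
  unfolding path_distortion_def
proof (intro allI impI)
  fix m :: nat and p :: "nat \<Rightarrow> 'a"
  assume p: "\<forall>i\<le>m. p i \<in> X"
  let ?xs = "map p [0..<Suc m]"
  have "?xs \<in> lists X" using p by (auto simp del: upt_Suc)
  then obtain ys where ys: "list_all2 (\<lambda>x y. y \<in> f x) ?xs ys"
    "path_length \<rho> ys \<le> t * path_length d ?xs"
    using assms unfolding path_lift_def by blast
  have l: "length ys = Suc m" using ys(1) list_all2_lengthD by fastforce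
  then have "ys = map (\<lambda>i. ys ! i) [0..<Suc m]" by (metis map_nth)
  then have "path_length \<rho> ys = (\<Sum>i<m. \<rho> (ys ! i) (ys ! Suc i))"
    using path_length_map_upt[of \<rho> "\<lambda>i. ys ! i" m] by metis
  moreover have "ys ! i \<in> f (p i)" if "i \<le> m" for i
    using list_all2_nthD[OF ys(1), of i] that by (simp del: upt_Suc)
  ultimately show "\<exists>p'. (\<forall>i\<le>m. p' i \<in> f (p i)) \<and>
       (\<Sum>i<m. \<rho> (p' i) (p' (Suc i))) \<le> t * (\<Sum>i<m. d (p i) (p (Suc i)))"
    using ys(2) unfolding path_length_map_upt by metis
qed

subsection \<open>Joining two clan embeddings\<close>

definition join_dist :: "real \<Rightarrow> (nat \<Rightarrow> nat \<Rightarrow> real) \<Rightarrow> (nat \<Rightarrow> nat \<Rightarrow> real) \<Rightarrow> nat \<Rightarrow> nat \<Rightarrow> real" where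
  "join_dist D \<rho>\<^sub>1 \<rho>\<^sub>2 u v =
     (if even u \<and> even v then \<rho>\<^sub>1 (u div 2) (v div 2)
      else if odd u \<and> odd v then \<rho>\<^sub>2 (u div 2) (v div 2) else D)"

definition join_copies ::
  "'a set \<Rightarrow> 'a set \<Rightarrow> ('a \<Rightarrow> nat set) \<Rightarrow> ('a \<Rightarrow> nat set) \<Rightarrow> 'a \<Rightarrow> nat set" where
  "join_copies A B f\<^sub>1 f\<^sub>2 x =
     (if x \<in> A then (\<lambda>y. 2 * y) ` f\<^sub>1 x else {}) \<union> (if x \<in> B then (\<lambda>y. Suc (2 * y)) ` f\<^sub>2 x else {})"

lemma join_dist_simps [simp]:
  "join_dist D \<rho>\<^sub>1 \<rho>\<^sub>2 (2 * u) (2 * v) = \<rho>\<^sub>1 u v"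
  "join_dist D \<rho>\<^sub>1 \<rho>\<^sub>2 (Suc (2 * u)) (Suc (2 * v)) = \<rho>\<^sub>2 u v"
  "join_dist D \<rho>\<^sub>1 \<rho>\<^sub>2 (2 * u) (Suc (2 * v)) = D"
  "join_dist D \<rho>\<^sub>1 \<rho>\<^sub>2 (Suc (2 * u)) (2 * v) = D"
  by (auto simp: join_dist_def)

lemma ultrametricI:
  assumes "\<And>x y. 0 \<le> d x y" "\<And>x y. d x y = d y x"
    "\<And>x y. \<lbrakk>x \<in> M; y \<in> M\<rbrakk> \<Longrightarrow> d x y = 0 \<longleftrightarrow> x = y"
    and u: "\<And>x y z. \<lbrakk>x \<in> M; y \<in> M; z \<in> M\<rbrakk> \<Longrightarrow> d x z \<le> max (d x y) (d y z)"
  shows "ultrametric M d"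
proof
  fix x y z assume "x \<in> M" "y \<in> M" "z \<in> M"
  then show "d x z \<le> d x y + d y z"
    using u[of x y z] assms(1)[of x y] assms(1)[of y z] by linarith
qed (use assms in auto)

lemma ultrametric_join:
  assumes "ultrametric Y\<^sub>1 \<rho>\<^sub>1" "ultrametric Y\<^sub>2 \<rho>\<^sub>2" "0 < D"
    and 1: "\<And>u v. \<lbrakk>u \<in> Y\<^sub>1; v \<in> Y\<^sub>1\<rbrakk> \<Longrightarrow> \<rho>\<^sub>1 u v \<le> D"
    and 2: "\<And>u v. \<lbrakk>u \<in> Y\<^sub>2; v \<in> Y\<^sub>2\<rbrakk> \<Longrightarrow> \<rho>\<^sub>2 u v \<le> D"
  shows "ultrametric ((\<lambda>y. 2 * y) ` Y\<^sub>1 \<union> (\<lambda>y. Suc (2 * y)) ` Y\<^sub>2) (join_dist D \<rho>\<^sub>1 \<rho>\<^sub>2)"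
    (is "ultrametric ?Y ?d")
proof -
  interpret a: ultrametric Y\<^sub>1 \<rho>\<^sub>1 by fact
  interpret b: ultrametric Y\<^sub>2 \<rho>\<^sub>2 by fact
  show ?thesis
  proof (rule ultrametricI)
    show "0 \<le> ?d x y" "?d x y = ?d y x" for x y
      using \<open>0 < D\<close> by (auto simp: join_dist_def a.commute b.commute)
    show "?d x y = 0 \<longleftrightarrow> x = y" if "x \<in> ?Y" "y \<in> ?Y" for x y
      using that \<open>0 < D\<close>
      by (elim UnE imageE) (auto, presburger+)
    show "?d x z \<le> max (?d x y) (?d y z)" if "x \<in> ?Y" "y \<in> ?Y" "z \<in> ?Y" for x y z
      using that 1 2
      by (elim UnE imageE) (auto simp: le_max_iff_disj simp del: mult_Suc_right dest: a.ultra_triangle b.ultra_triangle)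
  qed
qed

definition diam :: "('a \<Rightarrow> 'a \<Rightarrow> real) \<Rightarrow> 'a set \<Rightarrow> real" where
  "diam d Z = Max ((\<lambda>(x, y). d x y) ` (Z \<times> Z))"

lemma diam_ge: "\<lbrakk>finite Z; x \<in> Z; y \<in> Z\<rbrakk> \<Longrightarrow> d x y \<le> diam d Z"
  unfolding diam_def by (intro Max_ge) auto

lemma diam_le: "\<lbrakk>finite Z; Z \<noteq> {}; \<And>x y. \<lbrakk>x \<in> Z; y \<in> Z\<rbrakk> \<Longrightarrow> d x y \<le> D\<rbrakk> \<Longrightarrow> diam d Z \<le> D"
  unfolding diam_def by (subst Max_le_iff) auto

lemma diam_mono: "\<lbrakk>finite Z; A \<subseteq> Z; A \<noteq> {}\<rbrakk> \<Longrightarrow> diam d A \<le> diam d Z"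
  by (intro diam_le) (auto intro: diam_ge finite_subset)

definition ultra_clan ::
  "('a \<Rightarrow> 'a \<Rightarrow> real) \<Rightarrow> 'a set \<Rightarrow> real \<Rightarrow> (nat \<Rightarrow> nat \<Rightarrow> real) \<Rightarrow> ('a \<Rightarrow> nat set) \<Rightarrow> ('a \<Rightarrow> nat) \<Rightarrow> bool" where
  "ultra_clan d Z t \<rho> f chi \<longleftrightarrow>
     ultrametric (\<Union>x\<in>Z. f x) \<rho> \<and> (\<forall>x\<in>Z. finite (f x) \<and> chi x \<in> f x) \<and>
     (\<forall>x\<in>Z. \<forall>y\<in>Z. (\<forall>x'\<in>f x. \<forall>y'\<in>f y. d x y \<le> \<rho> x' y' \<and> \<rho> x' y' \<le> diam d Z) \<and>
        (\<exists>y'\<in>f y. \<rho> y' (chi x) \<le> t * d x y))"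

lemma ultra_clan_join:
  assumes Z: "Z = A \<union> B" "finite Z" "A \<noteq> {}" "B \<noteq> {}" and D: "0 < diam d Z"
    and 1: "ultra_clan d A t \<rho>\<^sub>1 f\<^sub>1 chi\<^sub>1" and 2: "ultra_clan d B t \<rho>\<^sub>2 f\<^sub>2 chi\<^sub>2"
    and S: "S \<subseteq> A" "Z - S \<subseteq> B"
    and SA: "\<And>x y. \<lbrakk>x \<in> S; y \<in> Z - A\<rbrakk> \<Longrightarrow> diam d Z \<le> t * d x y"
    and SB: "\<And>x y. \<lbrakk>x \<in> Z - S; y \<in> Z - B\<rbrakk> \<Longrightarrow> diam d Z \<le> t * d x y"
  shows "ultra_clan d Z t (join_dist (diam d Z) \<rho>\<^sub>1 \<rho>\<^sub>2) (join_copies A B f\<^sub>1 f\<^sub>2)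
    (\<lambda>x. if x \<in> S then 2 * chi\<^sub>1 x else Suc (2 * chi\<^sub>2 x))"
  unfolding ultra_clan_def
proof (intro conjI ballI)
  let ?D = "diam d Z"
  have le: "diam d A \<le> ?D" "diam d B \<le> ?D" using Z by (auto intro!: diam_mono)
  have U: "(\<Union>x\<in>Z. join_copies A B f\<^sub>1 f\<^sub>2 x)
    = (\<lambda>y. 2 * y) ` (\<Union>x\<in>A. f\<^sub>1 x) \<union> (\<lambda>y. Suc (2 * y)) ` (\<Union>x\<in>B. f\<^sub>2 x)"
    unfolding join_copies_def Z(1) by (auto split: if_splits) blast+
  have b1: "\<rho>\<^sub>1 u v \<le> ?D" "d x y \<le> \<rho>\<^sub>1 u v" if "x \<in> A" "y \<in> A" "u \<in> f\<^sub>1 x" "v \<in> f\<^sub>1 y" for x y u v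
    using 1 that le unfolding ultra_clan_def by (meson order_trans)+
  have b2: "\<rho>\<^sub>2 u v \<le> ?D" "d x y \<le> \<rho>\<^sub>2 u v" if "x \<in> B" "y \<in> B" "u \<in> f\<^sub>2 x" "v \<in> f\<^sub>2 y" for x y u v
    using 2 that le unfolding ultra_clan_def by (meson order_trans)+
  show "ultrametric (\<Union>x\<in>Z. join_copies A B f\<^sub>1 f\<^sub>2 x) (join_dist ?D \<rho>\<^sub>1 \<rho>\<^sub>2)"
    unfolding U using 1 2 D by (intro ultrametric_join) (auto simp: ultra_clan_def intro: b1 b2)
  fix x assume x: "x \<in> Z"
  show "finite (join_copies A B f\<^sub>1 f\<^sub>2 x)"
    using 1 2 by (auto simp: join_copies_def ultra_clan_def)
  show "(if x \<in> S then 2 * chi\<^sub>1 x else Suc (2 * chi\<^sub>2 x)) \<in> join_copies A B f\<^sub>1 f\<^sub>2 x"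
    using 1 2 S x by (auto simp: join_copies_def ultra_clan_def)
  fix y assume y: "y \<in> Z"
  show "\<exists>y'\<in>join_copies A B f\<^sub>1 f\<^sub>2 y.
      join_dist ?D \<rho>\<^sub>1 \<rho>\<^sub>2 y' (if x \<in> S then 2 * chi\<^sub>1 x else Suc (2 * chi\<^sub>2 x)) \<le> t * d x y"
  proof (cases "x \<in> S")
    case True
    show ?thesis
    proof (cases "y \<in> A")
      case yA: True
      then obtain y' where "y' \<in> f\<^sub>1 y" "\<rho>\<^sub>1 y' (chi\<^sub>1 x) \<le> t * d x y"
        using 1 True S unfolding ultra_clan_def by blast
      then show ?thesis using True yA by (intro bexI[of _ "2 * y'"]) (auto simp: join_copies_def)
    next
      case False
      then have yB: "y \<in> B" using y Z by auto
      then obtain y' where "y' \<in> f\<^sub>2 y" using 2 unfolding ultra_clan_def by blast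
      then show ?thesis using True SA[of x y] False yB y
        by (intro bexI[of _ "Suc (2 * y')"]) (auto simp: join_copies_def)
    qed
  next
    case False
    then have xB: "x \<in> B" using x S by auto
    show ?thesis
    proof (cases "y \<in> B")
      case yB: True
      then obtain y' where "y' \<in> f\<^sub>2 y" "\<rho>\<^sub>2 y' (chi\<^sub>2 x) \<le> t * d x y"
        using 2 xB unfolding ultra_clan_def by blast
      then show ?thesis using False yB
        by (intro bexI[of _ "Suc (2 * y')"]) (auto simp: join_copies_def)
    next
      case nB: False
      then have yA: "y \<in> A" using y Z by auto
      then obtain y' where "y' \<in> f\<^sub>1 y" using 1 unfolding ultra_clan_def by blast
      then show ?thesis using False SB[of x y] nB yA y x
        by (intro bexI[of _ "2 * y'"]) (auto simp: join_copies_def)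
    qed
  qed
  fix x' y' assume "x' \<in> join_copies A B f\<^sub>1 f\<^sub>2 x" "y' \<in> join_copies A B f\<^sub>1 f\<^sub>2 y"
  then show "d x y \<le> join_dist ?D \<rho>\<^sub>1 \<rho>\<^sub>2 x' y'" "join_dist ?D \<rho>\<^sub>1 \<rho>\<^sub>2 x' y' \<le> ?D"
    using b1 b2 x y Z diam_ge[OF Z(2) x y, of d]
    by (auto simp: join_copies_def simp del: mult_Suc_right split: if_splits)
qed

lemma card_join_copies:
  assumes "x \<in> A \<Longrightarrow> finite (f\<^sub>1 x)" "x \<in> B \<Longrightarrow> finite (f\<^sub>2 x)"
  shows "card (join_copies A B f\<^sub>1 f\<^sub>2 x)
    = (if x \<in> A then card (f\<^sub>1 x) else 0) + (if x \<in> B then card (f\<^sub>2 x) else 0)"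
proof -
  have "card ((\<lambda>y. 2 * y) ` F) = card F" for F :: "nat set" by (intro card_image inj_onI) auto
  moreover have "card ((\<lambda>y. Suc (2 * y)) ` F) = card F" for F :: "nat set"
    by (intro card_image inj_onI) auto
  moreover have "(\<lambda>y. 2 * y) ` F \<inter> (\<lambda>y. Suc (2 * y)) ` G = {}" for F G :: "nat set"
    by (auto, presburger)
  ultimately show ?thesis
    using assms unfolding join_copies_def by (auto simp: card_Un_disjoint)
qed

context Metric_space
begin

lemma diam_pos:
  assumes "finite Z" "Z \<subseteq> M" "2 \<le> card Z"
  shows "0 < diam d Z"
proof -
  obtain x y where "x \<in> Z" "y \<in> Z" "x \<noteq> y" 
    using assms(3) card_le_Suc0_iff_eq[OF assms(1)] by force
  then have "0 < d x y" using assms(2) by (meson mdist_pos_eq subset_iff)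
  then show ?thesis using diam_ge[OF assms(1) \<open>x \<in> Z\<close> \<open>y \<in> Z\<close>, of d] by linarith
qed

lemma clan_embedding_if_ultra_clan:
  assumes "finite M" and uc: "ultra_clan d M t \<rho> f chi"
  defines "Y \<equiv> \<Union>x\<in>M. f x"
  shows "ultrametric Y \<rho>" "clan_embedding M d Y \<rho> f chi" "multiplicative_distortion M d \<rho> f chi t"
proof -
  interpret Y: ultrametric Y \<rho> using uc by (simp add: ultra_clan_def Y_def)
  show "ultrametric Y \<rho>" ..
  have fin: "finite (f x)" "chi x \<in> f x" "f x \<noteq> {}" if "x \<in> M" for x
    using uc that by (auto simp: ultra_clan_def)
  have dom: "d x y \<le> \<rho> x' y'" if "x \<in> M" "y \<in> M" "x' \<in> f x" "y' \<in> f y" for x y x' y'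
    using uc that by (auto simp: ultra_clan_def)
  have "f x \<inter> f y = {}" if "x \<in> M" "y \<in> M" "x \<noteq> y" for x y
  proof (rule ccontr)
    assume "f x \<inter> f y \<noteq> {}"
    then obtain u where u: "u \<in> f x" "u \<in> f y" by auto
    then have "d x y \<le> \<rho> u u" using that dom by auto
    moreover have "u \<in> Y" using u that by (auto simp: Y_def)
    ultimately show False using that Y.mdist_zero by (metis mdist_pos_eq not_le)
  qed
  then have "one_to_many_embedding M Y f"
    unfolding one_to_many_embedding_def disjoint_family_on_def using fin by (fastforce simp: Y_def)
  moreover have "dominating M d \<rho> f"
    unfolding dominating_def
  proof (intro ballI)
    fix x y assume xy: "x \<in> M" "y \<in> M"
    have eq: "{\<rho> x' y' |x' y'. x' \<in> f x \<and> y' \<in> f y} = (\<lambda>(x', y'). \<rho> x' y') ` (f x \<times> f y)" by auto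
    show "d x y \<le> Min {\<rho> x' y' |x' y'. x' \<in> f x \<and> y' \<in> f y}"
      unfolding eq using fin xy dom[OF xy] by (subst Min_ge_iff) auto
  qed
  ultimately show "clan_embedding M d Y \<rho> f chi" using fin by (simp add: clan_embedding_def)
  show "multiplicative_distortion M d \<rho> f chi t"
    unfolding multiplicative_distortion_def
  proof (intro ballI)
    fix x y assume xy: "x \<in> M" "y \<in> M"
    then obtain y' where "y' \<in> f y" "\<rho> y' (chi x) \<le> t * d x y"
      using uc unfolding ultra_clan_def by blast
    moreover have "{\<rho> y' (chi x) |y'. y' \<in> f y} = (\<lambda>y'. \<rho> y' (chi x)) ` f y" by auto
    ultimately show "Min {\<rho> y' (chi x) |y'. y' \<in> f y} \<le> t * d x y"
      using fin xy by (metis (no_types, lifting) Min_le finite_imageI image_eqI order_trans)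
  qed
qed

end

subsection \<open>Choice of the annulus\<close>

lemma slow_growth_index:
  fixes a :: "nat \<Rightarrow> real"
  assumes mono: "\<And>i. i \<le> k \<Longrightarrow> a i \<le> a (Suc i)" and r: "0 \<le> r" and k: "1 \<le> k"
    and top: "a (Suc k) \<le> a 0 * r ^ k"
    and bad: "\<And>i j. \<lbrakk>i \<le> k; j \<le> k; bad i; bad j\<rbrakk> \<Longrightarrow> i = j"
  shows "\<exists>i\<le>k. \<not> bad i \<and> a (Suc i) \<le> r * a i"
proof (rule ccontr)
  assume "\<not> ?thesis"
  then have grow: "r * a i < a (Suc i)" if "i \<le> k" "\<not> bad i" for i using that by (meson not_le)
  obtain j where j: "\<And>i. \<lbrakk>i \<le> k; i \<noteq> j\<rbrakk> \<Longrightarrow> \<not> bad i" using bad by metis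
  define b where "b i = a (if i \<le> j then i else Suc i)" for i
  have step: "r * b i < b (Suc i)" if "i < k" for i
  proof (cases "i = j")
    case True
    have "r * a i \<le> r * a (Suc i)" using mono[of i] that r by (intro mult_left_mono) auto
    also have "\<dots> < a (Suc (Suc i))" using grow[of "Suc i"] j[of "Suc i"] that True by auto
    finally show ?thesis using True by (simp add: b_def)
  next
    case False
    then show ?thesis
      using grow[of i] grow[of "Suc i"] j[of i] j[of "Suc i"] that by (auto simp: b_def)
  qed
  have "a 0 * r ^ i < b i" if "1 \<le> i" "i \<le> k" for i
    using that
  proof (induction i rule: nat_induct_at_least)
    case base
    then show ?case using step[of 0] by (simp add: b_def mult.commute)
  next
    case (Suc i)
    then have "r * (a 0 * r ^ i) \<le> r * b i" using r by (intro mult_left_mono) auto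
    then show ?case using step[of i] Suc.prems by (simp add: algebra_simps)
  qed
  then have "a 0 * r ^ k < b k" using k by simp
  also have "b k \<le> a (Suc k)" using mono[of k] by (simp add: b_def)
  finally show False using top by simp
qed

definition trunc_ball :: "('a \<Rightarrow> 'a \<Rightarrow> real) \<Rightarrow> 'a set \<Rightarrow> 'a \<Rightarrow> real \<Rightarrow> 'a set" where
  "trunc_ball d Z v r = {x \<in> Z. d v x \<le> r}"

lemma trunc_ball_mono: "\<lbrakk>A \<subseteq> Z; r \<le> s\<rbrakk> \<Longrightarrow> trunc_ball d A v r \<subseteq> trunc_ball d Z v s"
  by (auto simp: trunc_ball_def)

lemma trunc_ball_subset: "trunc_ball d Z v r \<subseteq> Z"
  by (auto simp: trunc_ball_def)

text \<open>
  Among \<open>k + 1\<close> annuli at most one straddles half of the points. Leaving it out costs one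
  factor in the volume growth argument, which is why the radius is divided by \<open>k + 1\<close> and not \<open>k\<close>.
\<close>

lemma exists_cut_radius:
  fixes d :: "'a \<Rightarrow> 'a \<Rightarrow> real" and \<mu> :: "'a \<Rightarrow> real" and D :: real
  assumes Z: "finite Z" and D: "0 \<le> D" and k: "1 \<le> k"
    and \<mu>: "\<And>x. x \<in> Z \<Longrightarrow> 0 \<le> \<mu> x"
    and pos: "0 < sum \<mu> (trunc_ball d Z v (D / 8))"
    and m: "sum \<mu> (trunc_ball d Z v (D / 4)) \<le> m"
  defines "g \<equiv> D / (8 * (real k + 1))"
  obtains R where "0 \<le> R" "R + g \<le> D / 4"
    "sum \<mu> (trunc_ball d Z v (R + g)) \<le>
       (m / sum \<mu> (trunc_ball d Z v (D / 8))) powr (1 / real k) * sum \<mu> (trunc_ball d Z v R)"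
    "2 * card (trunc_ball d Z v (R + g)) \<le> card Z \<or> card Z \<le> 2 * card (trunc_ball d Z v R)"
proof -
  define B where "B i = trunc_ball d Z v (D / 8 + real i * g)" for i
  define bad where "bad i \<longleftrightarrow> \<not> (2 * card (B (Suc i)) \<le> card Z \<or> card Z \<le> 2 * card (B i))" for i
  have g: "0 \<le> g" using D by (simp add: g_def)
  have sub: "B i \<subseteq> B j" if "i \<le> j" for i j
    unfolding B_def using that g by (intro trunc_ball_mono add_left_mono mult_right_mono) auto
  have fin: "finite (B i)" for i using Z trunc_ball_subset finite_subset unfolding B_def by metis
  have \<mu>B: "0 \<le> \<mu> x" if "x \<in> B i" for x i
    using \<mu> that trunc_ball_subset unfolding B_def by fast
  define r where "r = (m / sum \<mu> (B 0)) powr (1 / real k)"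
  have g8: "(real k + 1) * g = D / 8"
  proof -
    have "0 < real k + 1" by simp
    then show ?thesis unfolding g_def by (simp add: field_simps)
  qed
  have top: "B (Suc k) = trunc_ball d Z v (D / 4)"
  proof -
    have "D / 8 + real (Suc k) * g = D / 4" using g8 by (simp add: algebra_simps)
    then show ?thesis by (simp only: B_def)
  qed
  have B0: "B 0 = trunc_ball d Z v (D / 8)" by (simp add: B_def)
  have mono: "sum \<mu> (B i) \<le> sum \<mu> (B (Suc i))" for i
    using sub[of i "Suc i"] fin \<mu>B by (intro sum_mono2) auto
  have "sum \<mu> (B 0) \<le> sum \<mu> (B (Suc k))" using sub[of 0 "Suc k"] fin \<mu>B
    by (intro sum_mono2) auto
  then have mpos: "0 < m / sum \<mu> (B 0)" using pos m top B0 by auto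
  have "r ^ k = (m / sum \<mu> (B 0)) powr (real k * (1 / real k))"
    unfolding r_def using mpos k by (intro powr_power) auto
  also have "\<dots> = m / sum \<mu> (B 0)" using mpos k by (simp del: abs_divide)
  finally have "r ^ k = m / sum \<mu> (B 0)" .
  then have vol: "sum \<mu> (B (Suc k)) \<le> sum \<mu> (B 0) * r ^ k" using m pos top B0 by simp
  have uniq: "i = j" if "bad i" "bad j" for i j
  proof (rule ccontr)
    have *: False if "bad i" "bad j" "i < j" for i j
    proof -
      have "card (B (Suc i)) \<le> card (B j)" using that sub fin by (intro card_mono) auto
      then show False using that unfolding bad_def by auto
    qed
    assume "i \<noteq> j"
    then show False using * that by (meson linorder_neqE_nat)
  qed
  obtain i where i: "i \<le> k" "\<not> bad i" "sum \<mu> (B (Suc i)) \<le> r * sum \<mu> (B i)"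
    using slow_growth_index[of k "\<lambda>i. sum \<mu> (B i)" r bad, OF mono _ k vol uniq]
    by (auto simp: r_def)
  define R where "R = D / 8 + real i * g"
  have R: "B i = trunc_ball d Z v R" "B (Suc i) = trunc_ball d Z v (R + g)"
    by (auto simp: B_def R_def algebra_simps)
  have "(real i + 1) * g \<le> (real k + 1) * g" using i(1) g by (intro mult_right_mono) auto
  then have "R + g \<le> D / 4" using g8 unfolding R_def by (simp add: algebra_simps)
  moreover have "0 \<le> R" using D g by (simp add: R_def)
  ultimately show thesis using that[of R] i R unfolding bad_def r_def B0 by auto
qed

subsection \<open>The hierarchical clan embedding\<close>

definition scale_depth :: "('a \<Rightarrow> 'a \<Rightarrow> real) \<Rightarrow> real \<Rightarrow> 'a set \<Rightarrow> real" where
  "scale_depth d \<delta> Z = (if card Z \<le> 1 then 0 else 1 + log 2 (diam d Z / \<delta>))"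

context Metric_space
begin

lemma scale_depth_mono:
  assumes "finite Z" "Z \<subseteq> M" "A \<subseteq> Z" "A \<noteq> {}" "0 < \<delta>"
    "\<And>x y. \<lbrakk>x \<in> Z; y \<in> Z; x \<noteq> y\<rbrakk> \<Longrightarrow> \<delta> \<le> d x y"
  shows "scale_depth d \<delta> A \<le> scale_depth d \<delta> Z"
proof -
  have c: "card A \<le> card Z" using assms by (intro card_mono)
  show ?thesis
  proof (cases "card A \<le> 1")
    case True
    show ?thesis
    proof (cases "card Z \<le> 1")
      case False
      then obtain x y where "x \<in> Z" "y \<in> Z" "x \<noteq> y"
        using card_le_Suc0_iff_eq[OF assms(1)] by force
      then have "\<delta> \<le> diam d Z" using assms(6) diam_ge[OF assms(1), of x y d] by fastforce
      then have "0 \<le> log 2 (diam d Z / \<delta>)" using assms(5) by simp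
      then show ?thesis using True by (simp add: scale_depth_def)
    qed (use True in \<open>simp add: scale_depth_def\<close>)
  next
    case False
    then have "0 < diam d A" using assms by (intro diam_pos) (auto intro: finite_subset)
    moreover have "diam d A \<le> diam d Z" using assms by (intro diam_mono) auto
    ultimately have "log 2 (diam d A / \<delta>) \<le> log 2 (diam d Z / \<delta>)"
      using assms(5) by (simp add: divide_right_mono)
    then show ?thesis using False c by (auto simp: scale_depth_def)
  qed
qed

lemma scale_depth_half:
  assumes "finite Z" "Z \<subseteq> M" "A \<subseteq> Z" "A \<noteq> {}" "0 < \<delta>" "2 \<le> card Z" "2 * diam d A \<le> diam d Z"
    "\<And>x y. \<lbrakk>x \<in> Z; y \<in> Z; x \<noteq> y\<rbrakk> \<Longrightarrow> \<delta> \<le> d x y"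
  shows "scale_depth d \<delta> A + 1 \<le> scale_depth d \<delta> Z"
proof (cases "card A \<le> 1")
  case True
  obtain x y where "x \<in> Z" "y \<in> Z" "x \<noteq> y"
    using assms(6) card_le_Suc0_iff_eq[OF assms(1)] by force
  then have "\<delta> \<le> diam d Z" using assms(8) diam_ge[OF assms(1), of x y d] by fastforce
  then have "0 \<le> log 2 (diam d Z / \<delta>)" using assms(5) by simp
  then show ?thesis using True assms(6) by (simp add: scale_depth_def)
next
  case False
  then have p: "0 < diam d A" using assms by (intro diam_pos) (auto intro: finite_subset)
  have "log 2 (2 * (diam d A / \<delta>)) \<le> log 2 (diam d Z / \<delta>)"
    using assms(5,7) p by (simp add: divide_right_mono)
  then have "1 + log 2 (diam d A / \<delta>) \<le> log 2 (diam d Z / \<delta>)"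
    using p assms(5) by (subst (asm) log_mult) auto
  then show ?thesis using False assms(6) by (auto simp: scale_depth_def)
qed

lemma ultra_clan_singleton:
  assumes "z \<in> M" "0 \<le> t"
  shows "ultra_clan d {z} t (\<lambda>u v. if u = v then 0 else 1) (\<lambda>_. {0}) (\<lambda>_. 0)"
  using assms by (auto simp: ultra_clan_def diam_def intro!: ultrametricI)

lemma path_lift_singleton:
  "path_lift d (\<lambda>u v. if u = v then 0 else 1) (\<lambda>_. {0}) {z} 0"
  unfolding path_lift_def
proof
  fix xs :: "'a list"
  have "path_length (\<lambda>u v. if u = v then 0 else 1) (map (\<lambda>_. 0) xs) = 0"
    by (induction xs rule: induct_list012) auto
  moreover have "list_all2 (\<lambda>x y. y \<in> {0}) xs (map (\<lambda>_. 0) xs)"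
    by (simp add: list_all2_conv_all_nth)
  ultimately show "\<exists>ys. list_all2 (\<lambda>x y. y \<in> {0}) xs ys \<and>
      path_length (\<lambda>u v. if u = v then 0 else 1) ys \<le> 0 * path_length d xs"
    by (metis mult_zero_left order_refl)
qed

lemma exists_heavy_ball:
  assumes "finite Z" "Z \<noteq> {}"
  obtains v where "v \<in> Z" "\<And>w. w \<in> Z \<Longrightarrow> sum \<mu> (trunc_ball d Z w r) \<le> (sum \<mu> (trunc_ball d Z v r) :: real)"
proof -
  let ?F = "(\<lambda>w. sum \<mu> (trunc_ball d Z w r)) ` Z"
  have "Max ?F \<in> ?F" using assms by (intro Max_in) auto
  then obtain v where "v \<in> Z" "Max ?F = sum \<mu> (trunc_ball d Z v r)" by auto
  then show thesis using that[of v] assms Max_ge[of ?F] by (metis finite_imageI image_eqI)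
qed

lemma exists_ultra_clan:
  fixes \<mu> :: "'a \<Rightarrow> real" and k :: nat
  assumes "finite Z" "Z \<noteq> {}" "Z \<subseteq> M" "1 \<le> k" "0 < \<delta>"
    "\<And>x. x \<in> Z \<Longrightarrow> 1 \<le> \<mu> x"
    "\<And>x y. \<lbrakk>x \<in> Z; y \<in> Z; x \<noteq> y\<rbrakk> \<Longrightarrow> \<delta> \<le> d x y"
    "\<And>v. v \<in> Z \<Longrightarrow> sum \<mu> (trunc_ball d Z v (diam d Z / 4)) \<le> m"
  shows "\<exists>\<rho> f chi. ultra_clan d Z (16 * (real k + 1)) \<rho> f chi \<and>
    (\<Sum>x\<in>Z. \<mu> x * real (card (f x))) \<le> sum \<mu> Z * m powr (1 / real k) \<and>
    path_lift d \<rho> f Z (16 * (real k + 1) * log 2 (card Z)) \<and>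
    path_lift d \<rho> f Z (16 * (real k + 1) * scale_depth d \<delta> Z)"
  using assms
proof (induction "card Z" arbitrary: Z m rule: less_induct)
  case (less Z m)
  note Z = less.prems(1-3) and k = less.prems(4) and \<delta> = less.prems(5,7) and \<mu> = less.prems(6)
  define t where "t = 16 * (real k + 1)"
  have t0: "0 \<le> t" by (simp add: t_def)
  show ?case
  proof (cases "card Z \<le> 1")
    case True
    then have "card Z = 1" using Z card_0_eq[of Z] by linarith
    then obtain z where z: "Z = {z}" by (auto simp: card_1_singleton_iff)
    then have zM: "z \<in> M" using Z by auto
    have "1 \<le> \<mu> z" using \<mu> z by auto
    moreover have "{x. x = z \<and> d z x \<le> 0} = {z}" using zM by auto
    then have "\<mu> z \<le> m"
      using less.prems(8)[of z] zM unfolding z by (simp add: trunc_ball_def diam_def)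
    ultimately have "1 \<le> m powr (1 / real k)" by (intro ge_one_powr_ge_zero) auto
    then have "\<mu> z \<le> \<mu> z * m powr (1 / real k)" using \<open>1 \<le> \<mu> z\<close> by simp
    then show ?thesis using ultra_clan_singleton[OF zM, of "16 * (real k + 1)"] path_lift_singleton[of z] unfolding z
      by (intro exI[of _ "\<lambda>u v. if u = v then 0 else 1"] exI[of _ "\<lambda>_. {0}"] exI[of _ "\<lambda>_. 0"])
        (simp add: scale_depth_def)
  next
    case False
    then have c2: "2 \<le> card Z" by simp
    define D where "D = diam d Z"
    have D: "0 < D" unfolding D_def using Z c2 by (intro diam_pos)
    obtain v where v: "v \<in> Z" and heavy: "\<And>w. w \<in> Z \<Longrightarrow>
        sum \<mu> (trunc_ball d Z w (D / 8)) \<le> sum \<mu> (trunc_ball d Z v (D / 8))"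
      using exists_heavy_ball[OF Z(1,2)] by metis
    define m' where "m' = sum \<mu> (trunc_ball d Z v (D / 8))"
    have vM: "v \<in> M" using v Z by auto
    have \<mu>0: "0 \<le> \<mu> x" if "x \<in> Z" for x using \<mu>[OF that] by simp
    have sum_mono_ball: "sum \<mu> S \<le> sum \<mu> T" if "S \<subseteq> T" "T \<subseteq> Z" for S T
      using that \<mu>0 finite_subset[OF that(2) Z(1)] by (intro sum_mono2) auto
    have "\<mu> v = sum \<mu> {v}" by simp
    also have "\<dots> \<le> m'" unfolding m'_def using v vM D
      by (intro sum_mono_ball) (auto simp: trunc_ball_def)
    finally have m': "1 \<le> m'" using \<mu>[OF v] by linarith
    define g where "g = D / (8 * (real k + 1))"
    have g: "0 < g" using D by (simp add: g_def add_pos_nonneg)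
    have tg: "t * g = 2 * D"
    proof -
      have "0 < real k + 1" by simp
      then show ?thesis unfolding g_def t_def by (simp add: field_simps)
    qed
    obtain R where R: "0 \<le> R" "R + g \<le> D / 4"
      "sum \<mu> (trunc_ball d Z v (R + g)) \<le> (m / m') powr (1 / real k) * sum \<mu> (trunc_ball d Z v R)"
      "2 * card (trunc_ball d Z v (R + g)) \<le> card Z \<or> card Z \<le> 2 * card (trunc_ball d Z v R)"
      using exists_cut_radius[of Z D k \<mu> d v m] Z D k \<mu>0 m' less.prems(8)[OF v]
      unfolding g_def m'_def D_def by (auto simp: less_imp_le)
    define A where "A = trunc_ball d Z v (R + g)"
    define Q where "Q = trunc_ball d Z v R"
    define B where "B = Z - Q"
    define S where "S = trunc_ball d Z v (R + g / 2)"
    have QA: "Q \<subseteq> A" unfolding Q_def A_def using g by (intro trunc_ball_mono) auto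
    have AZ: "A \<subseteq> Z" "Q \<subseteq> Z" by (auto simp: A_def Q_def trunc_ball_subset)
    have ZAB: "Z = A \<union> B" using AZ QA by (auto simp: B_def)
    have vQ: "v \<in> Q" using v vM R(1) by (simp add: Q_def trunc_ball_def)
    have "diam d A \<le> D / 2"
    proof (rule diam_le)
      show "finite A" using AZ(1) Z(1) by (rule finite_subset)
      show "A \<noteq> {}" using vQ QA by auto
      fix x y assume xy: "x \<in> A" "y \<in> A"
      then have "d x y \<le> d v x + d v y" using vM Z AZ by (metis commute subset_iff triangle)
      also have "\<dots> \<le> D / 4 + D / 4"
        using xy R(2) by (intro add_mono) (auto simp: A_def trunc_ball_def)
      finally show "d x y \<le> D / 2" by simp
    qed
    then have AD: "2 * diam d A \<le> D" by simp
    then have "A \<noteq> Z" using D by (auto simp: D_def)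
    then have "Q \<noteq> Z" using QA AZ by auto
    then have ne: "A \<noteq> {}" "B \<noteq> {}" using vQ QA AZ by (auto simp: B_def)
    have BZ: "B \<subset> Z" "A \<subset> Z" using vQ AZ \<open>A \<noteq> Z\<close> by (auto simp: B_def)
    have sub: "A \<subseteq> Z" "B \<subseteq> Z" using BZ by auto
    have fin: "finite A" "finite B" using Z(1) AZ(1) by (auto simp: B_def intro: finite_subset)
    have lt: "card A < card Z" "card B < card Z" using BZ Z by (auto intro: psubset_card_mono)
    have "\<exists>\<rho> f chi. ultra_clan d A (16 * (real k + 1)) \<rho> f chi \<and>
      (\<Sum>x\<in>A. \<mu> x * real (card (f x))) \<le> sum \<mu> A * m' powr (1 / real k) \<and>
      path_lift d \<rho> f A (16 * (real k + 1) * log 2 (card A)) \<and>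
      path_lift d \<rho> f A (16 * (real k + 1) * scale_depth d \<delta> A)"
    proof (rule less.hyps[OF lt(1) fin(1) ne(1)])
      show "\<delta> \<le> d x y" if "x \<in> A" "y \<in> A" "x \<noteq> y" for x y
        using that BZ \<delta>(2) by blast
      show "sum \<mu> (trunc_ball d A w (diam d A / 4)) \<le> m'" if "w \<in> A" for w
      proof -
        have "sum \<mu> (trunc_ball d A w (diam d A / 4)) \<le> sum \<mu> (trunc_ball d Z w (D / 8))"
          using AD AZ by (intro sum_mono_ball trunc_ball_mono trunc_ball_subset) auto
        also have "\<dots> \<le> m'" unfolding m'_def using heavy that AZ by auto
        finally show ?thesis .
      qed
    qed (use Z(3) k \<delta>(1) \<mu> sub in blast)+
    then obtain \<rho>\<^sub>1 f\<^sub>1 chi\<^sub>1 where 1: "ultra_clan d A t \<rho>\<^sub>1 f\<^sub>1 chi\<^sub>1"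
      "(\<Sum>x\<in>A. \<mu> x * real (card (f\<^sub>1 x))) \<le> sum \<mu> A * m' powr (1 / real k)"
      "path_lift d \<rho>\<^sub>1 f\<^sub>1 A (t * log 2 (card A))"
      "path_lift d \<rho>\<^sub>1 f\<^sub>1 A (t * scale_depth d \<delta> A)" unfolding t_def by blast
    have "\<exists>\<rho> f chi. ultra_clan d B (16 * (real k + 1)) \<rho> f chi \<and>
      (\<Sum>x\<in>B. \<mu> x * real (card (f x))) \<le> sum \<mu> B * m powr (1 / real k) \<and>
      path_lift d \<rho> f B (16 * (real k + 1) * log 2 (card B)) \<and>
      path_lift d \<rho> f B (16 * (real k + 1) * scale_depth d \<delta> B)"
    proof (rule less.hyps[OF lt(2) fin(2) ne(2)])
      show "\<delta> \<le> d x y" if "x \<in> B" "y \<in> B" "x \<noteq> y" for x y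
        using that BZ \<delta>(2) by blast
      show "sum \<mu> (trunc_ball d B w (diam d B / 4)) \<le> m" if "w \<in> B" for w
      proof -
        have "sum \<mu> (trunc_ball d B w (diam d B / 4)) \<le> sum \<mu> (trunc_ball d Z w (diam d Z / 4))"
          using BZ Z ne diam_mono[of Z B d]
          by (intro sum_mono_ball trunc_ball_mono trunc_ball_subset) auto
        also have "\<dots> \<le> m" using less.prems(8) that BZ by auto
        finally show ?thesis .
      qed
    qed (use Z(3) k \<delta>(1) \<mu> sub in blast)+
    then obtain \<rho>\<^sub>2 f\<^sub>2 chi\<^sub>2 where 2: "ultra_clan d B t \<rho>\<^sub>2 f\<^sub>2 chi\<^sub>2"
      "(\<Sum>x\<in>B. \<mu> x * real (card (f\<^sub>2 x))) \<le> sum \<mu> B * m powr (1 / real k)"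
      "path_lift d \<rho>\<^sub>2 f\<^sub>2 B (t * log 2 (card B))"
      "path_lift d \<rho>\<^sub>2 f\<^sub>2 B (t * scale_depth d \<delta> B)" unfolding t_def by blast
    define \<rho> where "\<rho> = join_dist D \<rho>\<^sub>1 \<rho>\<^sub>2"
    define f where "f = join_copies A B f\<^sub>1 f\<^sub>2"
    define chi where "chi = (\<lambda>x. if x \<in> S then 2 * chi\<^sub>1 x else Suc (2 * chi\<^sub>2 x))"
    have sep: "s - r \<le> d x y" if "x \<in> Z" "y \<in> Z" "d v x \<le> r" "s \<le> d v y" for x y r s
    proof -
      have "d v y \<le> d v x + d x y" using that vM Z by (intro triangle) auto
      then show ?thesis using that by linarith
    qed
    have tD: "D \<le> t * d x y" if "g / 2 \<le> d x y" for x y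
      using mult_left_mono[OF that t0] tg by simp
    have clan: "ultra_clan d Z t \<rho> f chi"
      unfolding \<rho>_def f_def chi_def D_def
    proof (rule ultra_clan_join[OF ZAB Z(1) ne _ 1(1) 2(1)])
      show "0 < diam d Z" using D by (simp add: D_def)
      show "S \<subseteq> A" unfolding S_def A_def using g by (intro trunc_ball_mono) auto
      show "Z - S \<subseteq> B" unfolding B_def S_def Q_def using g by (auto simp: trunc_ball_def)
      show "diam d Z \<le> t * d x y" if "x \<in> S" "y \<in> Z - A" for x y
      proof -
        have "R + g - (R + g / 2) \<le> d x y" using that
          by (intro sep) (auto simp: S_def A_def trunc_ball_def)
        then show ?thesis using tD[of x y] by (simp add: D_def)
      qed
      show "diam d Z \<le> t * d x y" if "x \<in> Z - S" "y \<in> Z - B" for x y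
      proof -
        have "R + g / 2 - R \<le> d y x" using that
          by (intro sep) (auto simp: S_def B_def Q_def trunc_ball_def)
        then show ?thesis using tD[of x y] by (simp add: D_def commute)
      qed
    qed
    have "(\<Sum>x\<in>Z. \<mu> x * real (card (f x)))
      = (\<Sum>x\<in>Z. (if x \<in> A then \<mu> x * real (card (f\<^sub>1 x)) else 0) + (if x \<in> B then \<mu> x * real (card (f\<^sub>2 x)) else 0))"
      using 1(1) 2(1) unfolding f_def
      by (intro sum.cong refl) (subst card_join_copies, auto simp: ultra_clan_def algebra_simps)
    also have "\<dots> = (\<Sum>x\<in>A. \<mu> x * real (card (f\<^sub>1 x))) + (\<Sum>x\<in>B. \<mu> x * real (card (f\<^sub>2 x)))"
      using Z BZ by (simp add: sum.distrib sum.inter_restrict[symmetric] Int_absorb1 psubset_imp_subset)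
    also have "\<dots> \<le> sum \<mu> A * m' powr (1 / real k) + sum \<mu> B * m powr (1 / real k)"
      using 1(2) 2(2) by (rule add_mono)
    also have "sum \<mu> A * m' powr (1 / real k)
        \<le> (m / m') powr (1 / real k) * sum \<mu> Q * m' powr (1 / real k)"
      using R(3) by (intro mult_right_mono) (auto simp: A_def Q_def)
    also have "\<dots> = sum \<mu> Q * m powr (1 / real k)"
    proof -
      have "m' \<le> sum \<mu> (trunc_ball d Z v (D / 4))" unfolding m'_def using D
        by (intro sum_mono_ball trunc_ball_mono trunc_ball_subset) auto
      then have "m' \<le> m" using less.prems(8)[OF v] by (simp add: D_def)
      then show ?thesis using m' by (simp add: powr_divide)
    qed
    also have "sum \<mu> Q * m powr (1 / real k) + sum \<mu> B * m powr (1 / real k)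
        = sum \<mu> Z * m powr (1 / real k)"
      using Z AZ sum.subset_diff[of Q Z \<mu>] by (simp add: B_def algebra_simps)
    finally have cost: "(\<Sum>x\<in>Z. \<mu> x * real (card (f x))) \<le> sum \<mu> Z * m powr (1 / real k)" by simp
    have liftA: "path_lift d \<rho> f A H" if "path_lift d \<rho>\<^sub>1 f\<^sub>1 A H" for H
      by (rule path_lift_map[OF that, of _ "\<lambda>y. 2 * y"]) (auto simp: \<rho>_def f_def join_copies_def)
    have liftB: "path_lift d \<rho> f B H" if "path_lift d \<rho>\<^sub>2 f\<^sub>2 B H" for H
      by (rule path_lift_map[OF that, of _ "\<lambda>y. Suc (2 * y)"]) (auto simp: \<rho>_def f_def join_copies_def)
    have \<rho>D: "\<rho> x' y' \<le> D" if "x \<in> Z" "y \<in> Z" "x' \<in> f x" "y' \<in> f y" for x y x' y'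
      using clan that by (auto simp: ultra_clan_def D_def)
    have gap: "g \<le> d x y" if "x \<in> A - B" "y \<in> B - A" for x y
    proof -
      have "R + g - R \<le> d x y" using that AZ BZ
        by (intro sep) (auto simp: A_def B_def Q_def trunc_ball_def)
      then show ?thesis by simp
    qed
    have glue1: "path_lift d \<rho> f Z H"
      if "path_lift d \<rho> f A a" "path_lift d \<rho> f B b" "a \<le> H - t" "b \<le> H" "t \<le> H" for a b H
    proof (rule path_lift_glue[where A = A and B = B and c = t and D = D and g = g])
      show "Z = A \<union> B" using ZAB by simp
      show "path_lift d \<rho> f A (H - t)" using that(1,3) by (rule path_lift_mono) simp
      show "path_lift d \<rho> f B H" using that(2,4) by (rule path_lift_mono) simp
      show "g \<le> d x y" if "x \<in> A - B" "y \<in> B - A" for x y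
        using that by (rule gap)
    qed (use Z(3) \<rho>D g D tg t0 that(5) in \<open>simp_all add: less_imp_le\<close>)
    have glue2: "path_lift d \<rho> f Z H"
      if "path_lift d \<rho> f A a" "path_lift d \<rho> f B b" "a \<le> H" "b \<le> H - t" "t \<le> H" for a b H
    proof (rule path_lift_glue[where A = B and B = A and c = t and D = D and g = g])
      show "Z = B \<union> A" using ZAB by blast
      show "path_lift d \<rho> f B (H - t)" using that(2,4) by (rule path_lift_mono) simp
      show "path_lift d \<rho> f A H" using that(1,3) by (rule path_lift_mono) simp
      show "g \<le> d x y" if "x \<in> B - A" "y \<in> A - B" for x y
        using gap[OF that(2,1)] by (simp add: commute)
    qed (use Z(3) \<rho>D g D tg t0 that(5) in \<open>simp_all add: less_imp_le\<close>)
    have pos: "0 < card A" "0 < card B" using fin ne by (auto simp: card_gt_0_iff)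
    have lg: "log 2 (card U) + 1 \<le> log 2 (card Z)" if "2 * card U \<le> card Z" "0 < card U" for U :: "'a set"
    proof -
      have "log 2 (2 * real (card U)) \<le> log 2 (card Z)" using that c2 by simp
      then show ?thesis using that by (simp add: log_mult)
    qed
    have tl: "t * x \<le> t * y - t" if "x + 1 \<le> y" for x y
      using mult_left_mono[OF that t0] by (simp add: algebra_simps)
    have tm: "t * x \<le> t * y" if "x \<le> y" for x y using that t0 by (rule mult_left_mono)
    have "1 \<le> log 2 (card Z)" using c2 by simp
    then have "path_lift d \<rho> f Z (t * log 2 (card Z))"
    proof -
      have tH: "t \<le> t * log 2 (card Z)" using tm[OF \<open>1 \<le> log 2 (card Z)\<close>] by simp
      have LA: "log 2 (card A) \<le> log 2 (card Z)" and LB: "log 2 (card B) \<le> log 2 (card Z)"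
        using lt pos by auto
      consider "2 * card A \<le> card Z" | "2 * card B \<le> card Z"
        using R(4) AZ Z card_Diff_subset[of Q Z] finite_subset unfolding A_def[symmetric] Q_def[symmetric] B_def
        by fastforce
      then show ?thesis
      proof cases
        case 1
        then show ?thesis
          using glue1[OF liftA[OF \<open>path_lift d \<rho>\<^sub>1 f\<^sub>1 A (t * log 2 (card A))\<close>] liftB[OF 2(3)] tl tm tH] lg pos LB by blast
      next
        case 2
        then show ?thesis
          using glue2[OF liftA[OF 1(3)] liftB[OF \<open>path_lift d \<rho>\<^sub>2 f\<^sub>2 B (t * log 2 (card B))\<close>] tm tl tH] lg pos LA by blast
      qed
    qed
    moreover have "path_lift d \<rho> f Z (t * scale_depth d \<delta> Z)"
    proof (rule glue1[OF liftA[OF 1(4)] liftB[OF 2(4)] tl tm])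
      have "scale_depth d \<delta> {v} \<le> scale_depth d \<delta> A"
      proof (rule scale_depth_mono)
        show "\<delta> \<le> d x y" if "x \<in> A" "y \<in> A" "x \<noteq> y" for x y
          using that sub \<delta>(2) by blast
      qed (use fin sub Z(3) vQ QA \<delta>(1) in blast)+
      then have "0 \<le> scale_depth d \<delta> A" by (simp add: scale_depth_def)
      moreover show h: "scale_depth d \<delta> A + 1 \<le> scale_depth d \<delta> Z"
        using Z BZ ne \<delta> AD c2 by (intro scale_depth_half) (auto simp: D_def)
      ultimately have "1 \<le> scale_depth d \<delta> Z" by linarith
      then show "t \<le> t * scale_depth d \<delta> Z" using tm by fastforce
      show "scale_depth d \<delta> B \<le> scale_depth d \<delta> Z"
        using Z BZ ne \<delta> by (intro scale_depth_mono) auto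
    qed
    ultimately show ?thesis using clan cost unfolding t_def by blast
  qed
qed

end

subsection \<open>Multiplicative weights\<close>

text \<open>
  Multiplicative weights: the potential is the sum over \<open>x\<close> of the exponential of the normalised total cost of \<open>x\<close>,
  and each new element is chosen for the weights that the potential currently puts on the points.
  The cost bound \<open>n * \<delta>\<close> permits the estimate \<open>exp z \<le> 1 + 2 * z\<close> for \<open>z\<close> in the unit interval.
\<close>

lemma exists_low_potential_sequence:
  fixes c :: "'e \<Rightarrow> 'a \<Rightarrow> real" and \<delta> :: real and n T :: nat
  assumes X: "finite X" "card X = n" "0 < n" and \<delta>: "0 < \<delta>"
    and ex: "\<And>w. (\<And>x. x \<in> X \<Longrightarrow> 0 < w x) \<Longrightarrow>
      \<exists>e. P e \<and> (\<Sum>x\<in>X. w x * c e x) \<le> \<delta> * sum w X"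
    and c: "\<And>e x. \<lbrakk>P e; x \<in> X\<rbrakk> \<Longrightarrow> 0 \<le> c e x \<and> c e x \<le> n * \<delta>"
  shows "\<exists>s. (\<forall>i<T. P (s i)) \<and>
    (\<Sum>x\<in>X. exp ((\<Sum>i<T. c (s i) x) / (n * \<delta>))) \<le> n * exp (2 * T / n)"
proof (induction T)
  case 0
  then show ?case using X by simp
next
  case (Suc T)
  then obtain s where s: "\<forall>i<T. P (s i)"
    "(\<Sum>x\<in>X. exp ((\<Sum>i<T. c (s i) x) / (n * \<delta>))) \<le> n * exp (2 * T / n)" by blast
  define w where "w x = exp ((\<Sum>i<T. c (s i) x) / (n * \<delta>))" for x
  obtain e where e: "P e" "(\<Sum>x\<in>X. w x * c e x) \<le> \<delta> * sum w X"
    using ex[of w] by (auto simp: w_def)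
  define s' where "s' = s(T := e)"
  have w': "exp ((\<Sum>i<Suc T. c (s' i) x) / (n * \<delta>)) \<le> w x * (1 + 2 * (c e x / (n * \<delta>)))"
    if "x \<in> X" for x
  proof -
    define z where "z = c e x / (n * \<delta>)"
    have z: "0 \<le> z" "z \<le> 1" using c[OF e(1) that] \<delta> X(3) by (auto simp: z_def divide_simps)
    have "(\<Sum>i<Suc T. c (s' i) x) / (n * \<delta>) = (\<Sum>i<T. c (s i) x) / (n * \<delta>) + z"
      by (simp add: s'_def z_def add_divide_distrib)
    moreover have "exp z \<le> 1 + 2 * z"
      using exp_bound[OF z] mult_left_le[of z z] z by (simp add: power2_eq_square)
    ultimately show ?thesis unfolding w_def z_def[symmetric] by (simp add: exp_add)
  qed
  have "(\<Sum>x\<in>X. exp ((\<Sum>i<Suc T. c (s' i) x) / (n * \<delta>))) \<le> (\<Sum>x\<in>X. w x * (1 + 2 * (c e x / (n * \<delta>))))"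
    using w' by (rule sum_mono)
  also have "\<dots> = sum w X + 2 * ((\<Sum>x\<in>X. w x * c e x) / (n * \<delta>))"
    by (simp add: distrib_left sum.distrib sum_divide_distrib sum_distrib_left mult_ac)
  also have "\<dots> \<le> sum w X + 2 * (\<delta> * sum w X / (n * \<delta>))"
    using e(2) \<delta> by (intro add_left_mono mult_left_mono divide_right_mono) auto
  also have "\<dots> = sum w X * (1 + 2 / n)" using \<delta> X(3) by (simp add: field_simps)
  also have "\<dots> \<le> (n * exp (2 * T / n)) * exp (2 / n)"
    using s(2) by (intro mult_mono) (auto simp: w_def)
  also have "\<dots> = n * exp (2 * Suc T / n)" by (simp add: exp_add[symmetric] add_divide_distrib add.commute)
  finally show ?case using s(1) e(1) by (intro exI[of _ s']) (auto simp: s'_def less_Suc_eq)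
qed

lemma exists_low_average_sequence:
  fixes c :: "'e \<Rightarrow> 'a \<Rightarrow> real" and \<delta> :: real
  assumes X: "finite X" "card X = n" "2 \<le> n" and \<delta>: "0 < \<delta>"
    and ex: "\<And>w. (\<And>x. x \<in> X \<Longrightarrow> 0 < w x) \<Longrightarrow>
      \<exists>e. P e \<and> (\<Sum>x\<in>X. w x * c e x) \<le> \<delta> * sum w X"
    and c: "\<And>e x. \<lbrakk>P e; x \<in> X\<rbrakk> \<Longrightarrow> 0 \<le> c e x \<and> c e x \<le> n * \<delta>"
  obtains T :: nat and s where "0 < T" "T \<le> 2 * (n * log 2 n)" "\<And>i. i < T \<Longrightarrow> P (s i)"
    "\<And>x. x \<in> X \<Longrightarrow> (\<Sum>i<T. c (s i) x) \<le> 3 * \<delta> * T"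
proof -
  define T where "T = nat \<lceil>n * log 2 n\<rceil>"
  have "1 \<le> log 2 n" using X(3) by simp
  then have "real n * 1 \<le> n * log 2 n" by (intro mult_left_mono) auto
  then have L: "2 \<le> n * log 2 n" using X(3) by linarith
  then have T: "n * log 2 n \<le> T" "T \<le> n * log 2 n + 1" unfolding T_def by linarith+
  obtain s where s: "\<forall>i<T. P (s i)"
    "(\<Sum>x\<in>X. exp ((\<Sum>i<T. c (s i) x) / (n * \<delta>))) \<le> n * exp (2 * T / n)"
    using exists_low_potential_sequence[of X n \<delta> P c T] assms by auto
  have "(\<Sum>i<T. c (s i) x) \<le> 3 * \<delta> * T" if "x \<in> X" for x
  proof -
    define a where "a = (\<Sum>i<T. c (s i) x) / (n * \<delta>)"
    have "exp a \<le> (\<Sum>x\<in>X. exp ((\<Sum>i<T. c (s i) x) / (n * \<delta>)))"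
      unfolding a_def using that X by (intro member_le_sum) auto
    also have "\<dots> \<le> n * exp (2 * T / n)" by (rule s(2))
    finally have "ln (exp a) \<le> ln (n * exp (2 * T / n))"
      using X(3) by (subst ln_le_cancel_iff) auto
    then have "a \<le> ln n + 2 * T / n" using X(3) by (simp add: ln_mult)
    also have "ln n \<le> log 2 n"
    proof -
      have "ln n * ln 2 \<le> ln n * 1" using X(3) ln_2_less_1 by (intro mult_left_mono) auto
      then show ?thesis by (simp add: log_def le_divide_eq)
    qed
    also have "log 2 n \<le> T / n" using T(1) X(3) by (simp add: field_simps)
    finally have "a \<le> 3 * T / n" by (simp add: field_simps)
    then have "a * (n * \<delta>) \<le> 3 * T / n * (n * \<delta>)" using \<delta> by (intro mult_right_mono) auto
    then show ?thesis using \<delta> X(3) unfolding a_def by (simp add: mult_ac)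
  qed
  moreover have "0 < T" using T(1) L by linarith
  moreover have "T \<le> 2 * (n * log 2 n)" using T(2) L by linarith
  ultimately show thesis using that s(1) by blast
qed

subsection \<open>The distribution\<close>

lemma Metric_space_positive_min_dist:
  assumes "Metric_space X d" "finite X" "2 \<le> card X"
  defines "\<delta> \<equiv> Min {d x y | x y. x \<in> X \<and> y \<in> X \<and> x \<noteq> y}"
  shows "0 < \<delta>" "\<And>x y. \<lbrakk>x \<in> X; y \<in> X; x \<noteq> y\<rbrakk> \<Longrightarrow> \<delta> \<le> d x y"
proof -
  interpret Metric_space X d by fact
  let ?S = "{d x y | x y. x \<in> X \<and> y \<in> X \<and> x \<noteq> y}"
  have "?S \<subseteq> (\<lambda>(x, y). d x y) ` (X \<times> X)" by auto
  then have fin: "finite ?S" using assms(2) by (meson finite_SigmaI finite_imageI finite_subset)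
  obtain x y where "x \<in> X" "y \<in> X" "x \<noteq> y"
    using assms(3) card_le_Suc0_iff_eq[OF assms(2)] by force
  then have "?S \<noteq> {}" by auto
  then have "\<delta> \<in> ?S" unfolding \<delta>_def using fin by (intro Min_in) auto
  then show "0 < \<delta>" using mdist_pos_eq by auto
  show "\<delta> \<le> d x y" if "x \<in> X" "y \<in> X" "x \<noteq> y" for x y
    unfolding \<delta>_def using fin that by (intro Min_le) auto
qed

definition good_clan_map :: "'a set \<Rightarrow> ('a \<Rightarrow> 'a \<Rightarrow> real) \<Rightarrow> nat \<Rightarrow> 'a clan_map \<Rightarrow> bool" where
  "good_clan_map X d k = (\<lambda>(Y, dY, f, chi). finite Y \<and>
     ultrametric Y dY \<and> clan_embedding X d Y dY f chi \<and>
     multiplicative_distortion X d dY f chi (16 * (real k + 1)) \<and>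
     path_distortion X d dY f (64 * real k * path_factor (card X) (aspect_ratio X d)))"

lemma exists_good_clan_map:
  fixes \<mu> :: "'a \<Rightarrow> real"
  assumes "Metric_space X d" and X: "finite X" "2 \<le> card X" and k: "1 \<le> k"
    and \<mu>: "\<And>x. x \<in> X \<Longrightarrow> 1 \<le> \<mu> x"
  shows "\<exists>Y dY f chi. good_clan_map X d k (Y, dY, f, chi) \<and>
    (\<Sum>x\<in>X. \<mu> x * real (card (f x))) \<le> sum \<mu> X * sum \<mu> X powr (1 / real k)"
proof -
  interpret Metric_space X d by fact
  define \<delta> where "\<delta> = Min {d x y | x y. x \<in> X \<and> y \<in> X \<and> x \<noteq> y}"
  note \<delta> = Metric_space_positive_min_dist[OF assms(1) X, folded \<delta>_def]
  have "X \<noteq> {}" using X by auto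
  moreover have "sum \<mu> (trunc_ball d X v r) \<le> sum \<mu> X" for v r
    using X \<mu> by (intro sum_mono2 trunc_ball_subset) (auto intro: order_trans[OF zero_le_one])
  ultimately obtain \<rho> f chi where uc: "ultra_clan d X (16 * (real k + 1)) \<rho> f chi"
    and cost: "(\<Sum>x\<in>X. \<mu> x * real (card (f x))) \<le> sum \<mu> X * sum \<mu> X powr (1 / real k)"
    and p1: "path_lift d \<rho> f X (16 * (real k + 1) * log 2 (card X))"
    and p2: "path_lift d \<rho> f X (16 * (real k + 1) * scale_depth d \<delta> X)"
    using exists_ultra_clan[of X k \<delta> \<mu> "sum \<mu> X"] X k \<mu> \<delta> by blast
  have asp: "aspect_ratio X d = diam d X / \<delta>"
  proof -
    have "{d x y |x y. x \<in> X \<and> y \<in> X} = (\<lambda>(x, y). d x y) ` (X \<times> X)" by auto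
    then show ?thesis by (simp add: aspect_ratio_def diam_def \<delta>_def)
  qed
  let ?t = "64 * real k * path_factor (card X) (aspect_ratio X d)"
  have k1: "16 * (real k + 1) \<le> 32 * real k" using k by simp
  have "path_lift d \<rho> f X ?t"
  proof (cases "log 2 (card X) \<le> max 1 (log 2 (aspect_ratio X d))")
    case True
    have "16 * (real k + 1) * log 2 (card X) \<le> 64 * real k * log 2 (card X)"
      using k1 X by (intro mult_right_mono) auto
    with p1 have "path_lift d \<rho> f X (64 * real k * log 2 (card X))"
      by (rule path_lift_mono) simp
    then show ?thesis using True by (simp add: path_factor_def min_def)
  next
    case False
    have "1 + log 2 (diam d X / \<delta>) \<le> 2 * max 1 (log 2 (diam d X / \<delta>))" by simp
    then have "16 * (real k + 1) * scale_depth d \<delta> X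
        \<le> 16 * (real k + 1) * (2 * max 1 (log 2 (diam d X / \<delta>)))"
      using X by (intro mult_left_mono) (auto simp: scale_depth_def)
    also have "\<dots> \<le> 32 * real k * (2 * max 1 (log 2 (diam d X / \<delta>)))"
      using k1 by (rule mult_right_mono) simp
    finally have "16 * (real k + 1) * scale_depth d \<delta> X
        \<le> 64 * real k * max 1 (log 2 (diam d X / \<delta>))" by simp
    with p2 have "path_lift d \<rho> f X (64 * real k * max 1 (log 2 (diam d X / \<delta>)))"
      by (rule path_lift_mono) simp
    then show ?thesis using False by (simp add: path_factor_def min_def asp)
  qed
  then have "good_clan_map X d k (\<Union>x\<in>X. f x, \<rho>, f, chi)"
    using clan_embedding_if_ultra_clan[OF X(1) uc] path_distortion_if_path_lift uc X(1)
    unfolding good_clan_map_def by (auto simp: ultra_clan_def)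
  then show ?thesis using cost by blast
qed

lemma good_clan_map_card:
  assumes "good_clan_map X d k (Y, dY, f, chi)" "x \<in> X"
  shows "1 \<le> card (f x)"
proof -
  have "f x \<noteq> {}" "finite (f x)" using assms
    unfolding good_clan_map_def clan_embedding_def one_to_many_embedding_def by auto
  then show ?thesis by (simp add: Suc_le_eq card_gt_0_iff)
qed

definition excess :: "'a clan_map \<Rightarrow> 'a \<Rightarrow> real" where
  "excess e x = (case e of (Y, dY, f, chi) \<Rightarrow> real (card (f x)) - 1)"

lemma exists_small_excess:
  fixes w :: "'a \<Rightarrow> real"
  assumes "Metric_space X d" and X: "finite X" "card X = n" "2 \<le> n" and k: "1 \<le> k"
    and w: "\<And>x. x \<in> X \<Longrightarrow> 0 < w x"
  defines "\<delta> \<equiv> 2 * ((2 * real n) powr (1 / real k) - 1)"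
  shows "\<exists>e. (good_clan_map X d k e \<and> (\<forall>x\<in>X. excess e x \<le> n * \<delta>)) \<and>
    (\<Sum>x\<in>X. w x * excess e x) \<le> \<delta> * sum w X"
proof -
  have "X \<noteq> {}" using X by auto
  then have W: "0 < sum w X" using X w by (intro sum_pos) auto
  define \<mu> where "\<mu> x = 1 + n * (w x / sum w X)" for x
  have \<mu>1: "1 \<le> \<mu> x" if "x \<in> X" for x using w[OF that] W by (simp add: \<mu>_def)
  have \<mu>X: "sum \<mu> X = 2 * n"
    using X W by (simp add: \<mu>_def sum.distrib sum_distrib_left[symmetric] sum_divide_distrib[symmetric])
  obtain Y dY f chi where e: "good_clan_map X d k (Y, dY, f, chi)" and
    cost: "(\<Sum>x\<in>X. \<mu> x * real (card (f x))) \<le> sum \<mu> X * sum \<mu> X powr (1 / real k)"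
    using exists_good_clan_map[of X d k \<mu>] assms(1) X k \<mu>1 by auto
  define c where "c x = real (card (f x)) - 1" for x
  have c0: "0 \<le> c x" if "x \<in> X" for x using good_clan_map_card[OF e that] by (simp add: c_def)
  have "(\<Sum>x\<in>X. \<mu> x * c x) = (\<Sum>x\<in>X. \<mu> x * real (card (f x))) - sum \<mu> X"
    by (simp add: c_def right_diff_distrib sum_subtractf)
  also have "\<dots> \<le> n * \<delta>" using cost unfolding \<mu>X \<delta>_def by (simp add: algebra_simps)
  finally have tot: "(\<Sum>x\<in>X. \<mu> x * c x) \<le> n * \<delta>" .
  have "c x \<le> n * \<delta>" if "x \<in> X" for x
  proof -
    have "c x \<le> \<mu> x * c x" using \<mu>1[OF that] c0[OF that] by (simp add: mult_le_cancel_right1)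
    also have "\<dots> \<le> (\<Sum>x\<in>X. \<mu> x * c x)"
      using that X \<mu>1 c0 by (intro member_le_sum) (auto intro!: mult_nonneg_nonneg intro: order_trans[OF zero_le_one])
    finally show ?thesis using tot by linarith
  qed
  moreover have "(\<Sum>x\<in>X. w x * c x) \<le> \<delta> * sum w X"
  proof -
    have "(n / sum w X) * (\<Sum>x\<in>X. w x * c x) = (\<Sum>x\<in>X. n * (w x / sum w X) * c x)"
      by (simp add: sum_distrib_left mult_ac)
    also have "\<dots> \<le> (\<Sum>x\<in>X. \<mu> x * c x)"
      using c0 by (intro sum_mono mult_right_mono) (auto simp: \<mu>_def)
    also note tot
    finally show ?thesis using W X(3) by (simp add: field_simps)
  qed
  ultimately show ?thesis using e unfolding excess_def c_def
    by (intro exI[of _ "(Y, dY, f, chi)"]) simp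
qed

text \<open>
  The members of a multiset of clan maps are made distinct by changing the target distance outside of
  the target carrier, where it is irrelevant.
\<close>

definition tag_dist :: "nat \<Rightarrow> nat set \<Rightarrow> (nat \<Rightarrow> nat \<Rightarrow> real) \<Rightarrow> nat \<Rightarrow> nat \<Rightarrow> real" where
  "tag_dist i Y dY u v = (if u \<in> Y \<and> v \<in> Y then dY u v else real i)"

definition tag_map :: "nat \<Rightarrow> 'a clan_map \<Rightarrow> 'a clan_map" where
  "tag_map i e = (case e of (Y, dY, f, chi) \<Rightarrow> (Y, tag_dist i Y dY, f, chi))"

lemma excess_tag_map [simp]: "excess (tag_map i e) = excess e"
  by (auto simp: excess_def tag_map_def split: prod.splits)

lemma tag_map_inj:
  assumes "good_clan_map X d k e" "tag_map i e = tag_map j e'"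
  shows "i = j"
proof -
  obtain Y dY f chi where e: "e = (Y, dY, f, chi)" by (cases e)
  obtain Y' dY' f' chi' where e': "e' = (Y', dY', f', chi')" by (cases e')
  have eq: "Y' = Y" "tag_dist i Y dY = tag_dist j Y dY'" using assms(2) by (auto simp: e e' tag_map_def)
  have "finite Y" using assms(1) by (simp add: e good_clan_map_def)
  then obtain a where "a \<notin> Y" using ex_new_if_finite infinite_UNIV_nat by blast
  then have "tag_dist i Y dY a a = real i" "tag_dist j Y dY' a a = real j" by (auto simp: tag_dist_def)
  then show ?thesis using eq by simp
qed

lemma good_clan_map_tag:
  assumes "good_clan_map X d k e"
  shows "good_clan_map X d k (tag_map i e)"
proof -
  obtain Y dY f chi where e: "e = (Y, dY, f, chi)" by (cases e)
  have *: "finite Y" "ultrametric Y dY" "clan_embedding X d Y dY f chi"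
     "multiplicative_distortion X d dY f chi (16 * (real k + 1))"
     "path_distortion X d dY f (64 * real k * path_factor (card X) (aspect_ratio X d))"
    using assms by (auto simp: e good_clan_map_def)
  interpret Y: ultrametric Y dY by fact
  have eq: "tag_dist i Y dY u v = dY u v" if "u \<in> Y" "v \<in> Y" for u v
    using that by (simp add: tag_dist_def)
  have fY: "u \<in> Y" if "x \<in> X" "u \<in> f x" for x u
    using *(3) that by (auto simp: clan_embedding_def one_to_many_embedding_def)
  have chiY: "chi x \<in> Y" if "x \<in> X" for x
    using *(3) that fY by (auto simp: clan_embedding_def)
  have "ultrametric Y (tag_dist i Y dY)"
    using Y.ultra_triangle by (intro ultrametricI) (auto simp: tag_dist_def Y.commute)
  moreover have "clan_embedding X d Y (tag_dist i Y dY) f chi"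
  proof -
    have "{tag_dist i Y dY x' y' |x' y'. x' \<in> f x \<and> y' \<in> f y} = {dY x' y' |x' y'. x' \<in> f x \<and> y' \<in> f y}"
      if "x \<in> X" "y \<in> X" for x y
      using that by (metis (no_types, opaque_lifting) eq fY)
    then show ?thesis using *(3) by (simp add: clan_embedding_def dominating_def)
  qed
  moreover have "multiplicative_distortion X d (tag_dist i Y dY) f chi (16 * (real k + 1))"
  proof -
    have "{tag_dist i Y dY y' (chi x) |y'. y' \<in> f y} = {dY y' (chi x) |y'. y' \<in> f y}"
      if "x \<in> X" "y \<in> X" for x y
      using that by (metis (no_types, opaque_lifting) eq fY chiY)
    then show ?thesis using *(4) by (simp add: multiplicative_distortion_def)
  qed
  moreover have "path_distortion X d (tag_dist i Y dY) f (64 * real k * path_factor (card X) (aspect_ratio X d))"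
    unfolding path_distortion_def
  proof (intro allI impI)
    fix m :: nat and p assume p: "\<forall>i\<le>m. p i \<in> X"
    then obtain p' where p': "\<forall>i\<le>m. p' i \<in> f (p i)"
      "(\<Sum>i<m. dY (p' i) (p' (Suc i)))
        \<le> 64 * real k * path_factor (card X) (aspect_ratio X d) * (\<Sum>i<m. d (p i) (p (Suc i)))"
      using *(5)[unfolded path_distortion_def, rule_format, of m p] by blast
    have "p' j \<in> Y" if "j \<le> m" for j using p p'(1) fY that by blast
    then have "(\<Sum>j<m. tag_dist i Y dY (p' j) (p' (Suc j))) = (\<Sum>j<m. dY (p' j) (p' (Suc j)))"
      by (intro sum.cong refl eq) simp_all
    with p' show "\<exists>p'. (\<forall>i\<le>m. p' i \<in> f (p i)) \<and> (\<Sum>j<m. tag_dist i Y dY (p' j) (p' (Suc j)))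
        \<le> 64 * real k * path_factor (card X) (aspect_ratio X d) * (\<Sum>i<m. d (p i) (p (Suc i)))"
      by (intro exI[of _ p']) simp
  qed
  ultimately show ?thesis using *(1) by (simp add: e tag_map_def good_clan_map_def)
qed

lemma exists_clan_distribution:
  assumes "Metric_space X d" and X: "finite X" "card X = n" "2 \<le> n" and k: "1 \<le> k"
  obtains S where "finite S" "S \<noteq> {}" "card S \<le> 2 * (n * log 2 n)" "\<And>e. e \<in> S \<Longrightarrow> good_clan_map X d k e"
    "\<And>x. x \<in> X \<Longrightarrow> expected_copies S x \<le> 1 + 6 * ((2 * real n) powr (1 / real k) - 1)"
proof -
  define \<delta> where "\<delta> = 2 * ((2 * real n) powr (1 / real k) - 1)"
  have "0 < \<delta>" using X(3) k gr_one_powr[of "2 * real n" "1 / real k"] by (simp add: \<delta>_def)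
  define P where "P e \<longleftrightarrow> good_clan_map X d k e \<and> (\<forall>x\<in>X. excess e x \<le> n * \<delta>)" for e
  have "\<exists>e. P e \<and> (\<Sum>x\<in>X. w x * excess e x) \<le> \<delta> * sum w X" if "\<And>x. x \<in> X \<Longrightarrow> 0 < w x" for w
    unfolding P_def \<delta>_def by (rule exists_small_excess[OF assms(1) X k that])
  moreover have "0 \<le> excess e x \<and> excess e x \<le> n * \<delta>" if "P e" "x \<in> X" for e x
    using that good_clan_map_card[of X d k _ _ _ _ x] unfolding P_def
    by (cases e) (force simp: excess_def)
  ultimately obtain T :: nat and s where T: "0 < T" "T \<le> 2 * (n * log 2 n)"
    and s: "\<And>i. i < T \<Longrightarrow> P (s i)" "\<And>x. x \<in> X \<Longrightarrow> (\<Sum>i<T. excess (s i) x) \<le> 3 * \<delta> * T"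
    using exists_low_average_sequence[of X n \<delta> P excess] X \<open>0 < \<delta>\<close> by blast
  define S where "S = (\<lambda>i. tag_map i (s i)) ` {..<T}"
  have inj: "inj_on (\<lambda>i. tag_map i (s i)) {..<T}"
  proof (rule inj_onI)
    fix i j assume "i \<in> {..<T}" "tag_map i (s i) = tag_map j (s j)"
    then show "i = j" using s(1)[of i] tag_map_inj[of X d k "s i" i j "s j"] by (simp add: P_def)
  qed
  have S: "finite S" "S \<noteq> {}" "card S = T" using T inj by (auto simp: S_def card_image)
  have "expected_copies S x \<le> 1 + 6 * ((2 * real n) powr (1 / real k) - 1)" if "x \<in> X" for x
  proof -
    have copies: "(\<lambda>(Y, dY, f, chi). real (card (f x))) = (\<lambda>e. excess e x + 1)"
      by (auto simp: excess_def)
    have "expected_copies S x = (\<Sum>e\<in>S. (excess e x + 1)) / T"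
      unfolding expected_copies_def copies using S by (simp add: integral_pmf_of_set)
    also have "(\<Sum>e\<in>S. (excess e x + 1)) = (\<Sum>i<T. excess (s i) x) + T"
      unfolding S_def by (subst sum.reindex[OF inj]) (simp add: sum.distrib)
    also have "\<dots> / T \<le> (3 * \<delta> * T + T) / T"
      using s(2)[OF that] by (intro divide_right_mono) auto
    also have "\<dots> = 1 + 3 * \<delta>" using T(1) by (simp add: field_simps)
    finally show ?thesis by (simp add: \<delta>_def)
  qed
  moreover have "good_clan_map X d k e" if "e \<in> S" for e
    using that s(1) good_clan_map_tag unfolding S_def P_def by blast
  ultimately show thesis using that S T by metis
qed

lemma multiplicative_distortion_mono:
  assumes "multiplicative_distortion X d dY f chi t" "t \<le> t'" "\<And>x y. 0 \<le> d x y"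
  shows "multiplicative_distortion X d dY f chi t'"
  unfolding multiplicative_distortion_def
proof (intro ballI)
  fix x y assume "x \<in> X" "y \<in> X"
  then have "Min {dY y' (chi x) | y'. y' \<in> f y} \<le> t * d x y"
    using assms(1) by (simp add: multiplicative_distortion_def)
  also have "\<dots> \<le> t' * d x y" using assms(2,3) by (rule mult_right_mono)
  finally show "Min {dY y' (chi x) | y'. y' \<in> f y} \<le> t' * d x y" .
qed

lemma path_distortion_mono:
  assumes "path_distortion X d dY f t" "t \<le> t'" "\<And>x y. 0 \<le> d x y"
  shows "path_distortion X d dY f t'"
  unfolding path_distortion_def
proof (intro allI impI)
  fix m :: nat and p assume "\<forall>i\<le>m. p i \<in> X"
  then obtain p' where p': "\<forall>i\<le>m. p' i \<in> f (p i)"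
    "(\<Sum>i<m. dY (p' i) (p' (Suc i))) \<le> t * (\<Sum>i<m. d (p i) (p (Suc i)))"
    using assms(1)[unfolded path_distortion_def, rule_format, of m p] by blast
  note p'(2)
  also have "t * (\<Sum>i<m. d (p i) (p (Suc i))) \<le> t' * (\<Sum>i<m. d (p i) (p (Suc i)))"
    using assms(2,3) by (intro mult_right_mono sum_nonneg)
  finally show "\<exists>p'. (\<forall>i\<le>m. p' i \<in> f (p i)) \<and>
      (\<Sum>i<m. dY (p' i) (p' (Suc i))) \<le> t' * (\<Sum>i<m. d (p i) (p (Suc i)))"
    using p'(1) by blast
qed

theorem theorem15:
  shows "\<exists>C::real. C > 0 \<and>
    (\<forall>(X :: 'a set) d (n::nat) (\<Phi>::real).
       Metric_space X d \<and> finite X \<and> card X = n \<and> n \<ge> 2 \<and> \<Phi> = aspect_ratio X d \<longrightarrow>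
       (\<forall>\<epsilon>::real. 0 < \<epsilon> \<and> \<epsilon> \<le> 1 \<longrightarrow>
          (\<exists>S :: 'a clan_map set.
             finite S \<and> S \<noteq> {} \<and> real (card S) \<le> C * (real n * log 2 n / \<epsilon>\<^sup>2) \<and>
             (\<forall>(Y, dY, f, chi)\<in>S.
                ultrametric Y dY \<and> clan_embedding X d Y dY f chi \<and>
                multiplicative_distortion X d dY f chi (C * (log 2 n / \<epsilon>)) \<and>
                path_distortion X d dY f (C * (log 2 n / \<epsilon>) * path_factor n \<Phi>)) \<and>
             (\<forall>x\<in>X. expected_copies S x \<le> 1 + \<epsilon>))) \<and>
       (\<forall>k::nat. k \<ge> 1 \<longrightarrow>
          (\<exists>S :: 'a clan_map set.
             finite S \<and> S \<noteq> {} \<and> real (card S) \<le> C * (real n powr (1 + 2 / real k) * log 2 n) \<and>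
             (\<forall>(Y, dY, f, chi)\<in>S.
                ultrametric Y dY \<and> clan_embedding X d Y dY f chi \<and>
                multiplicative_distortion X d dY f chi (16 * (real k + 1)) \<and>
                path_distortion X d dY f (C * real k * path_factor n \<Phi>)) \<and>
             (\<forall>x\<in>X. expected_copies S x \<le> C * real n powr (1 / real k)))))"
proof (intro exI[of _ "2048::real"] conjI allI impI)
  fix X :: "'a set" and d n \<Phi>
  assume "Metric_space X d \<and> finite X \<and> card X = n \<and> n \<ge> 2 \<and> \<Phi> = aspect_ratio X d"
  then have X: "Metric_space X d" "finite X" "card X = n" "2 \<le> n" and \<Phi>: "\<Phi> = aspect_ratio X d" by auto
  interpret Metric_space X d by fact
  have L: "1 \<le> log 2 n" using X(4) by simp
  then have pf: "0 \<le> path_factor n \<Phi>" by (simp add: path_factor_def)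
  have nL: "0 \<le> n * log 2 n" using L by simp
  {
    fix \<epsilon> :: real assume "0 < \<epsilon> \<and> \<epsilon> \<le> 1"
    then have \<epsilon>: "0 < \<epsilon>" "\<epsilon> \<le> 1" by auto
    define k where "k = nat \<lceil>12 * ln (2 * n) / \<epsilon>\<rceil>"
    have ln0: "0 < ln (2 * real n)" using X(4) by simp
    have k: "12 * ln (2 * n) / \<epsilon> \<le> k" "k \<le> 12 * ln (2 * n) / \<epsilon> + 1"
      unfolding k_def using ln0 \<epsilon> by (auto simp: ceiling_le_iff) 
    have "0 < 12 * ln (2 * n) / \<epsilon>" using ln0 \<epsilon> by simp
    then have k1: "1 \<le> k" using k(1) by linarith
    have lnL: "ln (2 * real n) \<le> 2 * log 2 n"
    proof -
      have "ln (2 * real n) = log 2 (2 * real n) * ln 2" by (simp add: log_def)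
      also have "\<dots> \<le> log 2 (2 * real n) * 1" using X(4) ln_2_less_1 by (intro mult_left_mono) auto
      also have "\<dots> = 1 + log 2 n" using X(4) by (simp add: log_mult)
      finally show ?thesis using L by simp
    qed
    have kL: "k \<le> 25 * (log 2 n / \<epsilon>)"
    proof -
      have "12 * ln (2 * n) / \<epsilon> \<le> 12 * (2 * log 2 n) / \<epsilon>"
        using lnL \<epsilon> by (intro divide_right_mono) auto
      moreover have "1 \<le> log 2 n / \<epsilon>" using L \<epsilon> by (simp add: field_simps)
      ultimately show ?thesis using k(2) by simp
    qed
    have exc: "6 * ((2 * real n) powr (1 / real k) - 1) \<le> \<epsilon>"
    proof -
      have "ln (2 * n) / k \<le> \<epsilon> / 12" using k(1) k1 \<epsilon> by (simp add: field_simps)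
      then have "(2 * real n) powr (1 / real k) \<le> exp (\<epsilon> / 12)" using X(4) by (simp add: powr_def)
      also have "\<dots> \<le> 1 + 2 * (\<epsilon> / 12)"
      proof -
        have "\<epsilon> * \<epsilon> \<le> \<epsilon>" using \<epsilon> by (intro mult_left_le) auto
        moreover have "exp (\<epsilon> / 12) \<le> 1 + \<epsilon> / 12 + \<epsilon> * \<epsilon> / 144"
          using exp_bound[of "\<epsilon> / 12"] \<epsilon> by (simp add: power2_eq_square)
        ultimately show ?thesis using \<epsilon> by linarith
      qed
      finally show ?thesis by simp
    qed
    obtain S where S: "finite S" "S \<noteq> {}" "card S \<le> 2 * (n * log 2 n)"
      "\<And>e. e \<in> S \<Longrightarrow> good_clan_map X d k e"
      "\<And>x. x \<in> X \<Longrightarrow> expected_copies S x \<le> 1 + 6 * ((2 * real n) powr (1 / real k) - 1)"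
      using exists_clan_distribution[OF X k1] by metis
    show "\<exists>S :: 'a clan_map set.
             finite S \<and> S \<noteq> {} \<and> real (card S) \<le> 2048 * (real n * log 2 n / \<epsilon>\<^sup>2) \<and>
             (\<forall>(Y, dY, f, chi)\<in>S.
                ultrametric Y dY \<and> clan_embedding X d Y dY f chi \<and>
                multiplicative_distortion X d dY f chi (2048 * (log 2 n / \<epsilon>)) \<and>
                path_distortion X d dY f (2048 * (log 2 n / \<epsilon>) * path_factor n \<Phi>)) \<and>
             (\<forall>x\<in>X. expected_copies S x \<le> 1 + \<epsilon>)"
    proof (intro exI[of _ S] conjI ballI)
      have "\<epsilon>\<^sup>2 \<le> 1" using \<epsilon> by (simp add: power_le_one)
      then have "n * log 2 n * \<epsilon>\<^sup>2 \<le> n * log 2 n * 1" using nL by (intro mult_left_mono)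
      then have "n * log 2 n \<le> n * log 2 n / \<epsilon>\<^sup>2" using \<epsilon> by (simp add: field_simps)
      then show "real (card S) \<le> 2048 * (real n * log 2 n / \<epsilon>\<^sup>2)" using S(3) nL by linarith
      show "expected_copies S x \<le> 1 + \<epsilon>" if "x \<in> X" for x using S(5)[OF that] exc by linarith
      fix e assume "e \<in> S"
      obtain Y dY f chi where e: "e = (Y, dY, f, chi)" by (cases e)
      note good = S(4)[OF \<open>e \<in> S\<close>, unfolded e good_clan_map_def prod.case X(3) \<Phi>[symmetric]]
      have t1: "16 * (real k + 1) \<le> 2048 * (log 2 n / \<epsilon>)" using kL k1 by simp
      have t2: "64 * real k * path_factor n \<Phi> \<le> 2048 * (log 2 n / \<epsilon>) * path_factor n \<Phi>"
        using kL pf by (intro mult_right_mono) auto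
      show "case e of (Y, dY, f, chi) \<Rightarrow> ultrametric Y dY \<and> clan_embedding X d Y dY f chi \<and>
                multiplicative_distortion X d dY f chi (2048 * (log 2 n / \<epsilon>)) \<and>
                path_distortion X d dY f (2048 * (log 2 n / \<epsilon>) * path_factor n \<Phi>)"
        unfolding e prod.case using good multiplicative_distortion_mono[where d = d, OF _ t1 nonneg]
          path_distortion_mono[where d = d, OF _ t2 nonneg] by blast
    qed (use S in auto)
  }
  {
    fix k :: nat assume k: "1 \<le> k"
    obtain S where S: "finite S" "S \<noteq> {}" "card S \<le> 2 * (n * log 2 n)"
      "\<And>e. e \<in> S \<Longrightarrow> good_clan_map X d k e"
      "\<And>x. x \<in> X \<Longrightarrow> expected_copies S x \<le> 1 + 6 * ((2 * real n) powr (1 / real k) - 1)"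
      using exists_clan_distribution[OF X k] by metis
    show "\<exists>S :: 'a clan_map set.
             finite S \<and> S \<noteq> {} \<and> real (card S) \<le> 2048 * (real n powr (1 + 2 / real k) * log 2 n) \<and>
             (\<forall>(Y, dY, f, chi)\<in>S.
                ultrametric Y dY \<and> clan_embedding X d Y dY f chi \<and>
                multiplicative_distortion X d dY f chi (16 * (real k + 1)) \<and>
                path_distortion X d dY f (2048 * real k * path_factor n \<Phi>)) \<and>
             (\<forall>x\<in>X. expected_copies S x \<le> 2048 * real n powr (1 / real k))"
    proof (intro exI[of _ S] conjI ballI)
      have "real n powr 1 \<le> real n powr (1 + 2 / real k)" using X(4) by (intro powr_mono) auto
      then have "n * log 2 n \<le> real n powr (1 + 2 / real k) * log 2 n"
        using L X(4) by (intro mult_right_mono) auto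
      then show "real (card S) \<le> 2048 * (real n powr (1 + 2 / real k) * log 2 n)"
        using S(3) nL by linarith
      show "expected_copies S x \<le> 2048 * real n powr (1 / real k)" if "x \<in> X" for x
      proof -
        have "(2::real) powr (1 / real k) \<le> 2 powr 1" using k by (intro powr_mono) auto
        then have "(2 * real n) powr (1 / real k) \<le> 2 * real n powr (1 / real k)"
          by (simp add: powr_mult mult_right_mono)
        moreover have "0 \<le> real n powr (1 / real k)" by simp
        ultimately show ?thesis using S(5)[OF that] by argo
      qed
      fix e assume "e \<in> S"
      obtain Y dY f chi where e: "e = (Y, dY, f, chi)" by (cases e)
      note good = S(4)[OF \<open>e \<in> S\<close>, unfolded e good_clan_map_def prod.case X(3) \<Phi>[symmetric]]
      have t2: "64 * real k * path_factor n \<Phi> \<le> 2048 * real k * path_factor n \<Phi>"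
        using pf by (intro mult_right_mono) auto
      show "case e of (Y, dY, f, chi) \<Rightarrow> ultrametric Y dY \<and> clan_embedding X d Y dY f chi \<and>
                multiplicative_distortion X d dY f chi (16 * (real k + 1)) \<and>
                path_distortion X d dY f (2048 * real k * path_factor n \<Phi>)"
        unfolding e prod.case using good path_distortion_mono[where d = d, OF _ t2 nonneg] by blast
    qed (use S in auto)
  }
qed simp

end
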